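(* Consider the overlaid primary and secondary networks on the unit square operating under the primary and secondary protocols described in the context, with primary cell area $a_p(n)=\frac{k_1\log n}{n}$, $k_1\ge 1$. Then the packet delay $D_p(n)$ of the primary network satisfies $$D_p(n)=\Theta\left(\frac{1}{\sqrt{a_p(n)}}\right)\quad\text{w.h.p.}$$
   Context: W.h.p. means with probability tending to 1 as $n\to\infty$. $O,\Omega,\Theta$ have their usual asymptotic meaning; $\log$ is the natural logarithm in the cell sizes. Network model. Primary nodes form a Poisson point process of density $n$ on the unit square and secondary nodes a Poisson point process of density $m=n^\beta$, $\beta>1$. Nodes of each network are randomly grouped into one-to-one source-destination (S-D) pairs. The channel power gain at distance $r$ is $g(r)=r^{-\alpha}$, $\alpha>2$, with noise power $N_0$ and unit bandwidth. An active transmitter (TX)/receiver (RX) pair at distance $d$ with transmit power $P$ has rate $\log\left(1+\frac{P g(d)}{N_0+I}\right)$, where $I$ is the total interference at the RX from all other active TXs of both networks (a TX of power $P'$ at distance $r$ contributes $P'g(r)$). Primary protocol. The unit square is divided into square primary cells of area $a_p=\frac{k_1\log n}{n}$, $k_1\ge1$, grouped into clusters of $25$ ($5\times5$) cells. Time is split into TDMA frames of 25 slots, each of constant length $t_p$; in each slot one cell per cluster is active, cells taking turns in round-robin fashion, with the same pattern in all clusters. The data path of an S-D pair is the horizontal line (HDP) followed by the vertical line (VDP) connecting source to destination. In each cell one node is the designated relay node (nodes take turns). When a cell is active, its slot is divided into packet slots, one for each data path passing through or originating from the cell: the relay transmits one packet for each path passing through the cell, then each source in the cell transmits one packet. Each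 packet goes to the relay node of the neighboring cell along the data path, or directly to the destination if that is the next hop (the destination may be in the same or a neighboring cell). Received packets are buffered and sent in the next active slot of the cell. TX power is $P_0a_p^{\alpha/2}$, $P_0$ constant. Secondary protocol. Same construction with square secondary cells of area $a_s=\frac{k_2\log m}{m}$, $k_2=k_1\ge1$, clusters of 25 cells, 25-slot TDMA, horizontal-then-vertical data paths, relay nodes, and TX power $P_1a_s^{\alpha/2}$, $P_1$ constant; one secondary TDMA frame has the duration $t_p$ of one primary slot. Around each primary cell containing an active primary TX there is a preservation region, a square of $M^2$ secondary cells, $M=\lfloor 3\sqrt{a_p/a_s}\rfloor+2$, in which no secondary node may transmit (but may receive). A relay node in a preservation region buffers packets until the region is cleared and its cell is active. Fluid model: the packet size scales proportionally to the throughput (arbitrarily small as the density grows), so that each packet arriving at a cell is sent at the next transmission opportunity of that cell. Delay. For a network with $n_t$ nodes, the delay $D_i(j)$ of packet $j$ of S-D pair $i$ is the time from departure from the source to arrival at the destination; $D_i=\limsup_{k\to\infty}\frac1k\sum_{j=1}^kD_i(j)$; and the packet delay is $D(n_t)=\frac{2}{n_t}\sum_{i=1}^{n_t/2}E[D_i]$. For the primary network it is written $D_p(n)$. *)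

theory Defs
  imports "HOL-Probability.Probability" "HOL-Combinatorics.Permutations"
begin

section \<open>Node placement and source-destination pairs\<close>

type_synonym point = "real \<times> real"

text \<open>Half-open, so that the square cells below partition it exactly.\<close>

definition unit_square :: "point set" where
  "unit_square = {0..<1} \<times> {0..<1}"

text \<open>
  One realization of one of the two networks: the number of nodes, their positions (only the
  indices below the number of nodes matter), and a permutation \<open>p\<close> of the node indices. The
  \<open>i\<close>-th S-D pair is the source \<open>p (2 * i)\<close> with the destination \<open>p (2 * i + 1)\<close>; if the number
  of nodes is odd, one node is in no pair, but it still serves as a relay.
\<close>

type_synonym tier = "nat \<times> (nat \<Rightarrow> point) \<times> (nat \<Rightarrow> nat)"

definition num_nodes :: "tier \<Rightarrow> nat" where "num_nodes T = fst T"
definition loc :: "tier \<Rightarrow> nat \<Rightarrow> point" where "loc T = fst (snd T)"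
definition pairing :: "tier \<Rightarrow> nat \<Rightarrow> nat" where "pairing T = snd (snd T)"

definition num_pairs :: "tier \<Rightarrow> nat" where "num_pairs T = num_nodes T div 2"
definition src :: "tier \<Rightarrow> nat \<Rightarrow> nat" where "src T i = pairing T (2 * i)"
definition dst :: "tier \<Rightarrow> nat \<Rightarrow> nat" where "dst T i = pairing T (2 * i + 1)"

definition placement_space :: "(nat \<times> (nat \<Rightarrow> point)) measure" where
  "placement_space = count_space UNIV \<Otimes>\<^sub>M (\<Pi>\<^sub>M v\<in>UNIV. borel)"

definition tier_space :: "tier measure" where
  "tier_space =
     count_space UNIV \<Otimes>\<^sub>M ((\<Pi>\<^sub>M v\<in>UNIV. borel) \<Otimes>\<^sub>M (\<Pi>\<^sub>M v\<in>UNIV. count_space UNIV))"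

definition point_count :: "tier \<Rightarrow> point set \<Rightarrow> nat" where
  "point_count T B = card {v. v < num_nodes T \<and> loc T v \<in> B}"

definition poisson_points :: "'w measure \<Rightarrow> real \<Rightarrow> ('w \<Rightarrow> tier) \<Rightarrow> bool" where
  "poisson_points M lam T \<longleftrightarrow>
     (\<forall>\<omega>\<in>space M. \<forall>v<num_nodes (T \<omega>). loc (T \<omega>) v \<in> unit_square) \<and>
     (\<forall>B\<in>sets borel. B \<subseteq> unit_square \<longrightarrow>
        (\<forall>k. measure M {\<omega>\<in>space M. point_count (T \<omega>) B = k} =
             exp (- (lam * measure lborel B)) * (lam * measure lborel B) ^ k / fact k)) \<and>
     (\<forall>(J :: nat set) B. finite J \<longrightarrow> disjoint_family_on B J \<longrightarrow>
        (\<forall>j\<in>J. B j \<in> sets borel \<and> B j \<subseteq> unit_square) \<longrightarrow>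
        prob_space.indep_vars M (\<lambda>_. count_space UNIV) (\<lambda>j \<omega>. point_count (T \<omega>) (B j)) J)"

text \<open>Given the placement, the pairing permutation is uniformly distributed.\<close>

definition uniform_pairing :: "'w measure \<Rightarrow> ('w \<Rightarrow> tier) \<Rightarrow> bool" where
  "uniform_pairing M T \<longleftrightarrow>
     (\<forall>\<omega>\<in>space M. pairing (T \<omega>) permutes {..<num_nodes (T \<omega>)}) \<and>
     (\<forall>B\<in>sets placement_space. \<forall>k p. p permutes {..<k} \<longrightarrow>
        measure M {\<omega>\<in>space M. (num_nodes (T \<omega>), loc (T \<omega>)) \<in> B \<and>
                              num_nodes (T \<omega>) = k \<and> pairing (T \<omega>) = p} =
        measure M {\<omega>\<in>space M. (num_nodes (T \<omega>), loc (T \<omega>)) \<in> B \<and> num_nodes (T \<omega>) = k} / fact k)"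

definition random_tier :: "'w measure \<Rightarrow> real \<Rightarrow> ('w \<Rightarrow> tier) \<Rightarrow> bool" where
  "random_tier M lam T \<longleftrightarrow>
     T \<in> M \<rightarrow>\<^sub>M tier_space \<and> poisson_points M lam T \<and> uniform_pairing M T"

text \<open>
  The predicate need not be measurable: it has to contain events whose probability tends to 1.
\<close>

definition whp :: "(nat \<Rightarrow> 'w measure) \<Rightarrow> (nat \<Rightarrow> 'w \<Rightarrow> bool) \<Rightarrow> bool" where
  "whp M P \<longleftrightarrow>
     (\<exists>A. (\<forall>n. A n \<in> sets (M n)) \<and> (\<forall>n. \<forall>\<omega>\<in>A n. P n \<omega>) \<and>
          (\<lambda>n. measure (M n) (A n)) \<longlonglongrightarrow> 1)"


section \<open>The cellular TDMA protocol of one network\<close>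

type_synonym cell = "int \<times> int"

text \<open>
  The choices left open by the protocol: \<open>pkt_order S c s\<close> lists the S-D pairs in the order in
  which they get the packet slots of cell \<open>c\<close> in slot \<open>s\<close>, and \<open>relay S c s\<close> is the designated
  relay node that forwards the buffered packets of \<open>c\<close> in slot \<open>s\<close>.
\<close>

record schedule =
  pkt_order :: "cell \<Rightarrow> nat \<Rightarrow> nat list"
  relay :: "cell \<Rightarrow> nat \<Rightarrow> nat"

text \<open>
  An operating network. Slot \<open>s\<close> is the time interval from \<open>s * slot_len\<close> to
  \<open>(s + 1) * slot_len\<close>, and \<open>opp c\<close> is the set of slots in which cell \<open>c\<close> may transmit. There are
  \<open>grid\<close> times \<open>grid\<close> cells, of side \<open>1 / grid\<close>.
\<close>

record net =
  tier :: tier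
  grid :: nat
  slot_len :: real
  opp :: "cell \<Rightarrow> nat set"
  sched :: schedule

definition cell_area :: "nat \<Rightarrow> real" where "cell_area K = 1 / (real K)\<^sup>2"

definition node_cell :: "net \<Rightarrow> nat \<Rightarrow> cell" where
  "node_cell A v =
     (\<lfloor>real (grid A) * fst (loc (tier A) v)\<rfloor>, \<lfloor>real (grid A) * snd (loc (tier A) v)\<rfloor>)"

definition cell_nodes :: "net \<Rightarrow> cell \<Rightarrow> nat set" where
  "cell_nodes A c = {v. v < num_nodes (tier A) \<and> node_cell A v = c}"

text \<open>
  \<open>data_path A i h\<close> is the \<open>h\<close>-th cell met by the horizontal segment from the source, followed by the
  vertical segment to the destination. The last hop leads directly to the destination, and a
  destination in the cell of the source is reached in one hop.
\<close>

definition data_path :: "net \<Rightarrow> nat \<Rightarrow> nat \<Rightarrow> cell" where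
  "data_path A i h =
     (let (x, y) = node_cell A (src (tier A) i);
          (x', y') = node_cell A (dst (tier A) i)
      in if int h \<le> \<bar>x' - x\<bar> then (x + sgn (x' - x) * int h, y)
         else (x', y + sgn (y' - y) * (int h - \<bar>x' - x\<bar>)))"

definition hops :: "net \<Rightarrow> nat \<Rightarrow> nat" where
  "hops A i =
     (let (x, y) = node_cell A (src (tier A) i);
          (x', y') = node_cell A (dst (tier A) i)
      in max 1 (nat (\<bar>x' - x\<bar> + \<bar>y' - y\<bar>)))"

definition passing :: "net \<Rightarrow> cell \<Rightarrow> nat set" where
  "passing A c = {i. i < num_pairs (tier A) \<and> (\<exists>h. 0 < h \<and> h < hops A i \<and> data_path A i h = c)}"

definition originating :: "net \<Rightarrow> cell \<Rightarrow> nat set" where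
  "originating A c = {i. i < num_pairs (tier A) \<and> data_path A i 0 = c}"

text \<open>
  The packet slots of the paths passing through a cell precede those of its sources, and all
  nodes of a cell take turns as its relay.
\<close>

definition valid_schedule :: "net \<Rightarrow> bool" where
  "valid_schedule A \<longleftrightarrow>
     (\<forall>c s. \<exists>xs ys. pkt_order (sched A) c s = xs @ ys \<and> distinct (xs @ ys) \<and>
        set xs = passing A c \<and> set ys = originating A c) \<and>
     (\<forall>c s. cell_nodes A c \<noteq> {} \<longrightarrow> relay (sched A) c s \<in> cell_nodes A c) \<and>
     (\<forall>c. \<forall>v\<in>cell_nodes A c. infinite (opp A c) \<longrightarrow>
        infinite {s \<in> opp A c. relay (sched A) c s = v})"

text \<open>
  The slot in which hop \<open>h\<close> of packet \<open>j\<close> of pair \<open>i\<close> takes place: the source sends one packet in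
  each of the slots of its cell, and (fluid model) a packet that arrived in a cell is sent at the
  next transmission opportunity of this cell.
\<close>

primrec hop_slot :: "net \<Rightarrow> nat \<Rightarrow> nat \<Rightarrow> nat \<Rightarrow> nat" where
  "hop_slot A i j 0 = enumerate (opp A (data_path A i 0)) j"
| "hop_slot A i j (Suc h) =
     (LEAST s. hop_slot A i j h < s \<and> s \<in> opp A (data_path A i (Suc h)))"

text \<open>
  A slot is divided evenly into the packet slots of the cell.
\<close>

definition pkt_time :: "net \<Rightarrow> nat \<Rightarrow> nat \<Rightarrow> nat \<Rightarrow> nat \<Rightarrow> real" where
  "pkt_time A i j h e =
     (let s = hop_slot A i j h;
          ps = pkt_order (sched A) (data_path A i h) s
      in slot_len A * (real s + real (length (takeWhile (\<lambda>i'. i' \<noteq> i) ps) + e) / real (length ps)))"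

definition pkt_start :: "net \<Rightarrow> nat \<Rightarrow> nat \<Rightarrow> nat \<Rightarrow> real" where
  "pkt_start A i j h = pkt_time A i j h 0"

definition pkt_end :: "net \<Rightarrow> nat \<Rightarrow> nat \<Rightarrow> nat \<Rightarrow> real" where
  "pkt_end A i j h = pkt_time A i j h 1"

text \<open>
  The relay that receives a packet is the one on duty when the packet is sent on.
\<close>

definition tx :: "net \<Rightarrow> nat \<Rightarrow> nat \<Rightarrow> nat \<Rightarrow> nat" where
  "tx A i j h =
     (if h = 0 then src (tier A) i else relay (sched A) (data_path A i h) (hop_slot A i j h))"

definition rx :: "net \<Rightarrow> nat \<Rightarrow> nat \<Rightarrow> nat \<Rightarrow> nat" where
  "rx A i j h =
     (if Suc h = hops A i then dst (tier A) i
      else relay (sched A) (data_path A i (Suc h)) (hop_slot A i j (Suc h)))"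

text \<open>
  Pair \<open>i\<close> can be served if every intermediate cell of its data path has a node to act as relay
  (and no cell is blocked forever, which can only happen to secondary cells). Other pairs stay
  silent.
\<close>

definition served :: "net \<Rightarrow> nat \<Rightarrow> bool" where
  "served A i \<longleftrightarrow>
     (\<forall>h. 0 < h \<and> h < hops A i \<longrightarrow> cell_nodes A (data_path A i h) \<noteq> {}) \<and>
     (\<forall>h<hops A i. infinite (opp A (data_path A i h)))"

definition active_tx :: "net \<Rightarrow> real \<Rightarrow> nat set" where
  "active_tx A t =
     {tx A i j h | i j h. i < num_pairs (tier A) \<and> served A i \<and> h < hops A i \<and>
        pkt_start A i j h \<le> t \<and> t < pkt_end A i j h}"

definition busy_cells :: "net \<Rightarrow> nat \<Rightarrow> cell set" where
  "busy_cells A s =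
     {data_path A i h | i j h. i < num_pairs (tier A) \<and> served A i \<and> h < hops A i \<and>
        hop_slot A i j h = s}"


section \<open>The overlaid networks\<close>

text \<open>
  \<open>turn1\<close> and \<open>turn2\<close> give the slot of a TDMA frame in which a cell is active, as a function of
  its position in its cluster of 5 times 5 cells.
\<close>

record params =
  k1 :: real
  k2 :: real
  alpha :: real
  beta :: real
  N0 :: real
  P0 :: real
  P1 :: real
  tp :: real
  turn1 :: "int \<times> int \<Rightarrow> nat"
  turn2 :: "int \<times> int \<Rightarrow> nat"

definition valid_params :: "params \<Rightarrow> bool" where
  "valid_params q \<longleftrightarrow>
     1 \<le> k1 q \<and> k2 q = k1 q \<and> 2 < alpha q \<and> 1 < beta q \<and>
     0 < N0 q \<and> 0 < P0 q \<and> 0 < P1 q \<and> 0 < tp q \<and>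
     bij_betw (turn1 q) ({0..<5} \<times> {0..<5}) {0..<25} \<and>
     bij_betw (turn2 q) ({0..<5} \<times> {0..<5}) {0..<25}"

definition dens2 :: "params \<Rightarrow> nat \<Rightarrow> real" where "dens2 q n = real n powr beta q"

definition a_p :: "params \<Rightarrow> nat \<Rightarrow> real" where "a_p q n = k1 q * ln (real n) / real n"
definition a_s :: "params \<Rightarrow> nat \<Rightarrow> real" where "a_s q n = k2 q * ln (dens2 q n) / dens2 q n"

text \<open>
  A square of area \<open>a\<close> tiles the unit square only if \<open>1 / sqrt a\<close> is an integer. In general the
  number of cells per side is this number rounded down, so that the cell area is
  \<open>cell_area (grid_of a)\<close>, which is at least \<open>a\<close> and asymptotically equal to \<open>a\<close>.
\<close>

definition grid_of :: "real \<Rightarrow> nat" where "grid_of a = nat \<lfloor>1 / sqrt a\<rfloor>"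

definition cluster_pos :: "cell \<Rightarrow> int \<times> int" where
  "cluster_pos c = (fst c mod 5, snd c mod 5)"

definition prim_net :: "params \<Rightarrow> nat \<Rightarrow> tier \<Rightarrow> schedule \<Rightarrow> net" where
  "prim_net q n T S =
     \<lparr>tier = T, grid = grid_of (a_p q n), slot_len = tp q,
      opp = (\<lambda>c. {s. s mod 25 = turn1 q (cluster_pos c)}), sched = S\<rparr>"

text \<open>
  The secondary cells of the preservation regions in slot \<open>s\<close> of the primary network \<open>A\<close>, for a
  secondary grid of \<open>Ks\<close> times \<open>Ks\<close> cells. As the two grids need not be aligned, the block of
  \<open>M\<close> times \<open>M\<close> secondary cells is centred at the primary cell up to rounding.
\<close>

definition preserved :: "net \<Rightarrow> nat \<Rightarrow> nat \<Rightarrow> cell set" where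
  "preserved A Ks s =
     (let M = \<lfloor>3 * sqrt (cell_area (grid A) / cell_area Ks)\<rfloor> + 2;
          corner = (\<lambda>x::int. round (real Ks * ((real_of_int x + 1/2) / real (grid A)) - real_of_int M / 2))
      in \<Union>c\<in>busy_cells A s.
           {corner (fst c)..<corner (fst c) + M} \<times> {corner (snd c)..<corner (snd c) + M})"

text \<open>
  A secondary frame of 25 slots lasts as long as one primary slot, so secondary slot \<open>s\<close> lies in
  primary slot \<open>s div 25\<close>.
\<close>

definition sec_net :: "params \<Rightarrow> nat \<Rightarrow> net \<Rightarrow> tier \<Rightarrow> schedule \<Rightarrow> net" where
  "sec_net q n A T S =
     (let Ks = grid_of (a_s q n)
      in \<lparr>tier = T, grid = Ks, slot_len = tp q / 25,
          opp = (\<lambda>c. {s. s mod 25 = turn2 q (cluster_pos c) \<and> c \<notin> preserved A Ks (s div 25)}),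
          sched = S\<rparr>)"

definition gain :: "params \<Rightarrow> real \<Rightarrow> real" where "gain q r = r powr (- alpha q)"

definition power1 :: "params \<Rightarrow> net \<Rightarrow> real" where
  "power1 q A = P0 q * cell_area (grid A) powr (alpha q / 2)"

definition power2 :: "params \<Rightarrow> net \<Rightarrow> real" where
  "power2 q B = P1 q * cell_area (grid B) powr (alpha q / 2)"

text \<open>
  Rate at time \<open>t\<close> from primary node \<open>u\<close> to primary node \<open>v\<close>, for the primary network \<open>A\<close>
  overlaid with the secondary network \<open>B\<close>.
\<close>

definition prim_rate :: "params \<Rightarrow> net \<Rightarrow> net \<Rightarrow> nat \<Rightarrow> nat \<Rightarrow> real \<Rightarrow> real" where
  "prim_rate q A B u v t =
     (let I = (\<Sum>w\<in>active_tx A t - {u}.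
                 power1 q A * gain q (dist (loc (tier A) w) (loc (tier A) v))) +
              (\<Sum>w\<in>active_tx B t.
                 power2 q B * gain q (dist (loc (tier B) w) (loc (tier A) v)))
      in ln (1 + power1 q A * gain q (dist (loc (tier A) u) (loc (tier A) v)) / (N0 q + I)))"

text \<open>
  A packet of size \<open>L\<close> fits into the packet slot of its hop \<open>h\<close>. Each source sends one packet per
  frame, so \<open>L\<close> is proportional to the throughput.
\<close>

definition fits :: "params \<Rightarrow> real \<Rightarrow> net \<Rightarrow> net \<Rightarrow> nat \<Rightarrow> nat \<Rightarrow> nat \<Rightarrow> bool" where
  "fits q L A B i j h \<longleftrightarrow>
     L \<le> integral {pkt_start A i j h..pkt_end A i j h}
           (prim_rate q A B (tx A i j h) (rx A i j h))"

definition fluid :: "params \<Rightarrow> real \<Rightarrow> net \<Rightarrow> net \<Rightarrow> bool" where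
  "fluid q L A B \<longleftrightarrow>
     0 < L \<and>
     (\<forall>i<num_pairs (tier A). served A i \<longrightarrow> (\<forall>j. \<forall>h<hops A i. fits q L A B i j h))"


section \<open>Delay of the primary network\<close>

definition packet_delay :: "params \<Rightarrow> real \<Rightarrow> net \<Rightarrow> net \<Rightarrow> nat \<Rightarrow> nat \<Rightarrow> ennreal" where
  "packet_delay q L A B i j =
     (if served A i \<and> (\<forall>h<hops A i. fits q L A B i j h)
      then ennreal (pkt_end A i j (hops A i - 1) - pkt_start A i j 0) else \<infinity>)"

definition pair_delay :: "params \<Rightarrow> real \<Rightarrow> net \<Rightarrow> net \<Rightarrow> nat \<Rightarrow> ennreal" where
  "pair_delay q L A B i =
     limsup (\<lambda>k. (\<Sum>j<k. packet_delay q L A B i j) / of_nat k)"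

text \<open>
  The packet delay for given realizations \<open>T1\<close>, \<open>T2\<close> of the primary and the secondary network.
  The expectation is over the scheduling choices, which are random variables on \<open>Q\<close>.
\<close>

definition prim_delay ::
  "params \<Rightarrow> nat \<Rightarrow> real \<Rightarrow> tier \<Rightarrow> tier \<Rightarrow> 's measure \<Rightarrow> ('s \<Rightarrow> schedule) \<Rightarrow> ('s \<Rightarrow> schedule) \<Rightarrow> ennreal"
where
  "prim_delay q n L T1 T2 Q S1 S2 =
     ennreal (2 / real (num_nodes T1)) *
     (\<Sum>i<num_pairs T1.
        \<integral>\<^sup>+ \<xi>. (let A = prim_net q n T1 (S1 \<xi>) in
              pair_delay q L A (sec_net q n A T2 (S2 \<xi>)) i) \<partial>Q)"

definition random_schedule :: "'s measure \<Rightarrow> ('s \<Rightarrow> schedule) \<Rightarrow> bool" where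
  "random_schedule Q S \<longleftrightarrow>
     (\<forall>c s. (\<lambda>\<xi>. pkt_order (S \<xi>) c s) \<in> Q \<rightarrow>\<^sub>M count_space UNIV \<and>
            (\<lambda>\<xi>. relay (S \<xi>) c s) \<in> Q \<rightarrow>\<^sub>M count_space UNIV)"

end

theory Submission
  imports Defs "HOL-Real_Asymp.Real_Asymp"
begin

text \<open>
  In the primary network a served packet waits between 1 and 25 slots at each hop, so its delay is
  of the order of its hop count, whatever the secondary network does. Hop counts are at most twice
  the grid size \<open>K \<approx> 1 / sqrt a_p\<close>. A cell is empty with probability at most \<open>1 / n\<close> and there are at
  most \<open>n / ln n\<close> cells, so w.h.p. all pairs are served, which gives the upper bound. For the lower
  bound, the second moment method, applied to the uniform pairing for a fixed placement, shows that
  w.h.p. a constant fraction of the pairs lead from the western to the eastern third of the square;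
  each of these needs at least about \<open>K / 3\<close> hops.
\<close>

section \<open>Events with high probability\<close>

text \<open>Delays live in \<open>ennreal\<close>: a packet that is not served or does not fit
  counts as infinitely late. Such packets cannot hurt the lower bound, which rests on consecutive
  hops taking place in distinct slots; the upper bound must exclude them. The union bound over empty
  cells has little room: for \<open>k1 q = 1\<close> it leaves \<open>1 / ln n\<close>, the
  logarithm coming from the number of cells. Rounding the grid size down enlarges the cells, which
  is the safe direction. The pairs cut out by a random permutation are dependent, so the number of
  crossing pairs is controlled by counting permutations with two or four prescribed values.
  \<open>uniform_pairing\<close> fixes the law of the pairing only relative to placement events. The
  number of crossing pairs depends on the placement only through the index sets of the two strips,
  so the placements are split by these sets; with at most \<open>2 * n\<close> nodes, finitely many
  cases remain. Constants: each strip holds at least \<open>n / 6\<close> of at most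
  \<open>2 * n\<close> nodes, a fraction 1/12; hence the mean number of crossing pairs is at least
  1/144 of all pairs, and 1/288 is half of this.\<close>

lemma whpI:
  assumes "\<And>n. prob_space (M n)" and "\<And>n. bad n \<in> sets (M n)"
    and "(\<lambda>n. measure (M n) (bad n)) \<longlonglongrightarrow> 0"
    and "\<forall>\<^sub>F n in sequentially. \<forall>\<omega>\<in>space (M n) - bad n. P n \<omega>"
  shows "whp M P"
proof -
  \<comment> \<open>\<open>whp\<close> demands \<open>P\<close> on the witness for every
    \<open>n\<close>, so the witness is made empty at the finitely many \<open>n\<close> where the
    implication fails.\<close>
  define A where "A = (\<lambda>n. if \<forall>\<omega>\<in>space (M n) - bad n. P n \<omega> then space (M n) - bad n else {})"
  have "\<forall>\<^sub>F n in sequentially. 1 - measure (M n) (bad n) = measure (M n) (A n)"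
    using assms(4)
  proof eventually_elim
    case (elim n)
    interpret prob_space "M n" by (rule assms)
    show ?case using elim assms(2) by (simp add: A_def prob_compl)
  qed
  moreover have "(\<lambda>n. 1 - measure (M n) (bad n)) \<longlonglongrightarrow> 1"
    using tendsto_diff[OF tendsto_const assms(3), of 1] by simp
  ultimately have "(\<lambda>n. measure (M n) (A n)) \<longlonglongrightarrow> 1"
    by (rule Lim_transform_eventually[rotated])
  moreover have "\<forall>n. A n \<in> sets (M n)" using assms(2) by (auto simp: A_def)
  moreover have "\<forall>n. \<forall>\<omega>\<in>A n. P n \<omega>" by (auto simp: A_def)
  ultimately show ?thesis unfolding whp_def by blast
qed

text \<open>Inclusion-exclusion is applied to the measurable witnesses, because the predicates
  themselves may be nonmeasurable.\<close>

lemma whp_conj: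
  assumes ps: "\<And>n. prob_space (M n)" and "whp M P" "whp M R"
  shows "whp M (\<lambda>n \<omega>. P n \<omega> \<and> R n \<omega>)"
proof -
  obtain A where A: "\<And>n. A n \<in> sets (M n)" "\<And>n. \<forall>\<omega>\<in>A n. P n \<omega>" "(\<lambda>n. measure (M n) (A n)) \<longlonglongrightarrow> 1"
    using assms(2) unfolding whp_def by auto
  obtain B where B: "\<And>n. B n \<in> sets (M n)" "\<And>n. \<forall>\<omega>\<in>B n. R n \<omega>" "(\<lambda>n. measure (M n) (B n)) \<longlonglongrightarrow> 1"
    using assms(3) unfolding whp_def by auto
  have "(\<lambda>n. measure (M n) (A n \<inter> B n)) \<longlonglongrightarrow> 1"
  proof (rule tendsto_sandwich)
    show "(\<lambda>n. measure (M n) (A n) + measure (M n) (B n) - 1) \<longlonglongrightarrow> 1"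
      using tendsto_diff[OF tendsto_add[OF A(3) B(3)] tendsto_const, of 1] by simp
    show "\<forall>\<^sub>F n in sequentially. measure (M n) (A n) + measure (M n) (B n) - 1 \<le> measure (M n) (A n \<inter> B n)"
    proof (rule always_eventually, rule allI)
      fix n
      interpret prob_space "M n" by (rule ps)
      have "prob (A n \<union> B n) = prob (A n) + prob (B n) - prob (A n \<inter> B n)"
        using A(1) B(1) by (intro measure_Un3) (auto simp: fmeasurable_eq_sets)
      moreover have "prob (A n \<union> B n) \<le> 1" by simp
      ultimately show "prob (A n) + prob (B n) - 1 \<le> prob (A n \<inter> B n)" by linarith
    qed
    show "\<forall>\<^sub>F n in sequentially. measure (M n) (A n \<inter> B n) \<le> 1"
      by (intro always_eventually allI prob_space.prob_le_1 ps)
  qed simp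
  then show ?thesis unfolding whp_def using A(1,2) B(1,2)
    by (intro exI[of _ "\<lambda>n. A n \<inter> B n"]) auto
qed

lemma whp_mono:
  assumes ps: "\<And>n. prob_space (M n)" and "whp M P"
    and "\<forall>\<^sub>F n in sequentially. \<forall>\<omega>\<in>space (M n). P n \<omega> \<longrightarrow> R n \<omega>"
  shows "whp M R"
proof -
  obtain A where A: "\<And>n. A n \<in> sets (M n)" "\<And>n. \<forall>\<omega>\<in>A n. P n \<omega>" "(\<lambda>n. measure (M n) (A n)) \<longlonglongrightarrow> 1"
    using assms(2) unfolding whp_def by auto
  show ?thesis
  proof (rule whpI[OF ps])
    show "space (M n) - A n \<in> sets (M n)" for n using A by auto
    have "measure (M n) (space (M n) - A n) = 1 - measure (M n) (A n)" for n
      using prob_space.prob_compl[OF ps A(1)] .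
    then show "(\<lambda>n. measure (M n) (space (M n) - A n)) \<longlonglongrightarrow> 0"
      using tendsto_diff[OF tendsto_const A(3), of 1] by simp
    show "\<forall>\<^sub>F n in sequentially. \<forall>\<omega>\<in>space (M n) - (space (M n) - A n). R n \<omega>"
      using assms(3) by eventually_elim (use A(2) in blast)
  qed
qed

section \<open>Long-run averages of extended nonnegative sequences\<close>

lemma limsup_average_le:
  fixes f :: "nat \<Rightarrow> ennreal"
  assumes "\<And>j. f j \<le> C"
  shows "limsup (\<lambda>k. (\<Sum>j<k. f j) / of_nat k) \<le> C"
proof (rule Limsup_bounded)
  show "\<forall>\<^sub>F k in sequentially. (\<Sum>j<k. f j) / of_nat k \<le> C"
    using eventually_gt_at_top[of 0]
  proof eventually_elim
    case (elim k)
    have "(\<Sum>j<k. f j) \<le> C * of_nat k"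
      using sum_mono[of "{..<k}" f "\<lambda>_. C"] assms by (simp add: mult.commute)
    then have "(\<Sum>j<k. f j) / of_nat k \<le> (C * of_nat k) / of_nat k"
      by (rule divide_right_mono_ennreal)
    also have "\<dots> = C" using elim by (intro mult_divide_eq_ennreal) auto
    finally show ?case .
  qed
qed

lemma le_limsup_average:
  fixes f :: "nat \<Rightarrow> ennreal"
  assumes "\<And>j. C \<le> f j"
  shows "C \<le> limsup (\<lambda>k. (\<Sum>j<k. f j) / of_nat k)"
proof (rule le_Limsup)
  show "\<forall>\<^sub>F k in sequentially. C \<le> (\<Sum>j<k. f j) / of_nat k"
    using eventually_gt_at_top[of 0]
  proof eventually_elim
    case (elim k)
    have "C * of_nat k \<le> (\<Sum>j<k. f j)"
      using sum_mono[of "{..<k}" "\<lambda>_. C" f] assms by (simp add: mult.commute)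
    then have "(C * of_nat k) / of_nat k \<le> (\<Sum>j<k. f j) / of_nat k"
      by (rule divide_right_mono_ennreal)
    then show ?case using elim by (subst (asm) mult_divide_eq_ennreal) auto
  qed
qed simp

section \<open>Uniformly random pairings\<close>

text \<open>The injection \<open>g\<close> extends to a permutation \<open>s\<close> of
  \<open>A\<close>. Composition with \<open>s\<close> then carries the permutations fixing
  \<open>D\<close> pointwise, i.e. those of \<open>A - D\<close>, bijectively to the permutations
  that agree with \<open>g\<close> on \<open>D\<close>.\<close>

lemma card_permutes_prescribed:
  fixes A :: "'a set"
  assumes "finite A" "D \<subseteq> A" "g ` D \<subseteq> A" "inj_on g D"
  shows "card {p. p permutes A \<and> (\<forall>x\<in>D. p x = g x)} = fact (card A - card D)"
proof -
  have fD: "finite D" using assms finite_subset by blast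
  have "card (A - D) = card (A - g ` D)"
    using assms fD by (simp add: card_Diff_subset card_image)
  then obtain f where f: "bij_betw f (A - D) (A - g ` D)"
    using assms(1) by (metis finite_Diff finite_same_card_bij)
  define s where "s = (\<lambda>x. if x \<in> D then g x else if x \<in> A then f x else x)"
  have "bij_betw s D (g ` D)"
    using assms(4) by (auto simp: s_def bij_betw_def inj_on_def)
  moreover have "bij_betw s (A - D) (A - g ` D)"
    using f by (subst bij_betw_cong[of _ _ f]) (auto simp: s_def)
  ultimately have "bij_betw s (D \<union> (A - D)) (g ` D \<union> (A - g ` D))"
    by (rule bij_betw_combine) auto
  then have s: "s permutes A"
    using assms by (intro bij_imp_permutes) (auto simp: s_def Un_absorb1)
  have "bij_betw (\<lambda>p. s \<circ> p) {p. p permutes (A - D)} {p. p permutes A \<and> (\<forall>x\<in>D. p x = g x)}"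
  proof (rule bij_betw_byWitness[where f' = "\<lambda>p. inv s \<circ> p"])
    show "\<forall>p\<in>{p. p permutes (A - D)}. inv s \<circ> (s \<circ> p) = p"
      using permutes_inv_o[OF s] by (auto simp: o_assoc)
    show "\<forall>p\<in>{p. p permutes A \<and> (\<forall>x\<in>D. p x = g x)}. s \<circ> (inv s \<circ> p) = p"
      using permutes_inv_o[OF s] by (auto simp: o_assoc)
    show "(\<lambda>p. s \<circ> p) ` {p. p permutes (A - D)} \<subseteq> {p. p permutes A \<and> (\<forall>x\<in>D. p x = g x)}"
    proof clarsimp
      fix p assume p: "p permutes (A - D)"
      then have "p permutes A" by (rule permutes_subset) auto
      then show "(s \<circ> p) permutes A \<and> (\<forall>x\<in>D. s (p x) = g x)"
        using p s by (auto intro: permutes_compose simp: permutes_not_in s_def)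
    qed
    show "(\<lambda>p. inv s \<circ> p) ` {p. p permutes A \<and> (\<forall>x\<in>D. p x = g x)} \<subseteq> {p. p permutes (A - D)}"
    proof clarsimp
      fix p assume p: "p permutes A" "\<forall>x\<in>D. p x = g x"
      have c: "(inv s \<circ> p) permutes A" using p s by (intro permutes_compose permutes_inv)
      have "(inv s \<circ> p) x = x" if "x \<in> D" for x
      proof -
        have "p x = s x" using p that by (simp add: s_def)
        then show ?thesis using permutes_inverses[OF s] by simp
      qed
      then show "(inv s \<circ> p) permutes (A - D)"
        by (intro permutes_superset[OF c]) auto
    qed
  qed
  then have "card {p. p permutes A \<and> (\<forall>x\<in>D. p x = g x)} = card {p. p permutes (A - D)}"
    by (simp add: bij_betw_same_card)
  also have "\<dots> = fact (card A - card D)"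
    using assms(1,2) fD by (intro card_permutations) (auto simp: card_Diff_subset)
  finally show ?thesis .
qed

lemma card_permutes_prescribed2:
  assumes "a < k" "b < k" "a \<noteq> b" "u < k" "v < k" "u \<noteq> v"
  shows "card {p. p permutes {..<k} \<and> p a = u \<and> p b = v} = fact (k - 2)"
proof -
  have "card {p. p permutes {..<k} \<and> (\<forall>x\<in>{a, b}. p x = (id(a := u, b := v)) x)} = fact (card {..<k} - card {a, b})"
    by (rule card_permutes_prescribed) (use assms in auto)
  then show ?thesis using assms by (simp add: eval_nat_numeral)
qed

lemma card_permutes_prescribed4:
  assumes "{a, b, c, d} \<subseteq> {..<k}" "distinct [a, b, c, d]"
    and "{u, v, w, z} \<subseteq> {..<k}" "distinct [u, v, w, z]"
  shows "card {p. p permutes {..<k} \<and> p a = u \<and> p b = v \<and> p c = w \<and> p d = z} = fact (k - 4)"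
proof -
  have "card {p. p permutes {..<k} \<and> (\<forall>x\<in>{a, b, c, d}. p x = (id(a := u, b := v, c := w, d := z)) x)}
     = fact (card {..<k} - card {a, b, c, d})"
    by (rule card_permutes_prescribed) (use assms in auto)
  moreover have "card {a, b, c, d} = 4"
    using distinct_card[OF assms(2)] by simp
  moreover have "(\<forall>x\<in>{a, b, c, d}. p x = (id(a := u, b := v, c := w, d := z)) x) \<longleftrightarrow>
      p a = u \<and> p b = v \<and> p c = w \<and> p d = z" for p :: "nat \<Rightarrow> nat"
    using assms(2) by auto
  ultimately show ?thesis by simp
qed

text \<open>With \<open>U\<close> and \<open>V\<close> the indices of the nodes in the two strips,
  this is the set of crossing pairs, detached from the geometry so that it can be averaged over
  permutations alone.\<close>

definition linked :: "nat \<Rightarrow> 'a set \<Rightarrow> 'a set \<Rightarrow> (nat \<Rightarrow> 'a) \<Rightarrow> nat set" where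
  "linked m U V p = {i. i < m \<and> p (2 * i) \<in> U \<and> p (2 * i + 1) \<in> V}"

context
  fixes k :: nat and U V :: "nat set"
  assumes U: "U \<subseteq> {..<k}" and V: "V \<subseteq> {..<k}" and disj: "U \<inter> V = {}"
begin

private abbreviation "perms \<equiv> {p. p permutes {..<k}}"

private lemma fin: "finite perms" "finite U" "finite V"
  using U V by (auto intro: finite_permutations finite_subset)

text \<open>Since \<open>U\<close> and \<open>V\<close> are disjoint, the two prescribed images
  always differ, so every choice in \<open>U \<times> V\<close> is realized by exactly
  \<open>fact (k - 2)\<close> permutations.\<close>

lemma card_permutes_link:
  assumes "i < k div 2"
  shows "card {p \<in> perms. p (2 * i) \<in> U \<and> p (2 * i + 1) \<in> V} = card U * card V * fact (k - 2)"
proof -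
  have "{p \<in> perms. p (2 * i) \<in> U \<and> p (2 * i + 1) \<in> V} =
      (\<Union>(u, v)\<in>U \<times> V. {p. p permutes {..<k} \<and> p (2 * i) = u \<and> p (2 * i + 1) = v})"
    by auto
  also have "card \<dots> = (\<Sum>(u, v)\<in>U \<times> V. card {p. p permutes {..<k} \<and> p (2 * i) = u \<and> p (2 * i + 1) = v})"
    using fin by (subst card_UN_disjoint) (auto intro: finite_subset[OF _ fin(1)] simp: split_def)
  also have "\<dots> = (\<Sum>(u, v)\<in>U \<times> V. fact (k - 2))"
  proof (intro sum.cong refl)
    fix x assume "x \<in> U \<times> V"
    moreover obtain u v where "x = (u, v)" by fastforce
    ultimately show "(case x of (u, v) \<Rightarrow> card {p. p permutes {..<k} \<and> p (2 * i) = u \<and> p (2 * i + 1) = v})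
        = (case x of (u, v) \<Rightarrow> fact (k - 2))"
      using U V disj assms by (auto intro!: card_permutes_prescribed2)
  qed
  finally show ?thesis by (simp add: card_cartesian_product)
qed

text \<open>Only an inequality: quadruples that repeat a source or a destination are realized by no
  permutation, but are counted on the right. The loss is of lower order and does not spoil the
  variance bound.\<close>

lemma card_permutes_link2:
  assumes "i < k div 2" "j < k div 2" "i \<noteq> j"
  shows "card {p \<in> perms. (p (2 * i) \<in> U \<and> p (2 * i + 1) \<in> V) \<and> (p (2 * j) \<in> U \<and> p (2 * j + 1) \<in> V)}
     \<le> (card U * card V)\<^sup>2 * fact (k - 4)"
proof -
  let ?S = "\<lambda>(u, v, w, z). {p. p permutes {..<k} \<and> p (2 * i) = u \<and> p (2 * i + 1) = v \<and> p (2 * j) = w \<and> p (2 * j + 1) = z}"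
  have "{p \<in> perms. (p (2 * i) \<in> U \<and> p (2 * i + 1) \<in> V) \<and> (p (2 * j) \<in> U \<and> p (2 * j + 1) \<in> V)} =
      (\<Union>x\<in>U \<times> V \<times> U \<times> V. ?S x)"
    by auto
  also have "card \<dots> \<le> (\<Sum>x\<in>U \<times> V \<times> U \<times> V. card (?S x))"
    using fin by (intro card_UN_le) auto
  also have "\<dots> \<le> (\<Sum>x\<in>U \<times> V \<times> U \<times> V. fact (k - 4))"
  proof (rule sum_mono)
    fix x assume x: "x \<in> U \<times> V \<times> U \<times> V"
    obtain u v w z where [simp]: "x = (u, v, w, z)" by (metis surj_pair)
    show "card (?S x) \<le> fact (k - 4)"
    proof (cases "u = w \<or> v = z")
      case True
      have "?S x = {}"
      proof (rule ccontr)
        assume "?S x \<noteq> {}"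
        then obtain p where p: "p permutes {..<k}" "p (2 * i) = u" "p (2 * i + 1) = v" "p (2 * j) = w" "p (2 * j + 1) = z"
          by auto
        then have "p (2 * i) = p (2 * j) \<or> p (2 * i + 1) = p (2 * j + 1)" using True by auto
        then have "2 * i = 2 * j \<or> 2 * i + 1 = 2 * j + 1"
          using permutes_inj[OF p(1)] by (meson injD)
        then show False using assms by auto
      qed
      then show ?thesis by (metis card.empty zero_le)
    next
      case False
      have "2 * i \<noteq> 2 * j + 1" "2 * j \<noteq> 2 * i + 1" by presburger+
      moreover have "u \<noteq> v" "u \<noteq> z" "w \<noteq> v" "w \<noteq> z" using x disj by auto
      ultimately have "distinct [2 * i, 2 * i + 1, 2 * j, 2 * j + 1]" "distinct [u, v, w, z]"
        using assms False by auto
      moreover have "{2 * i, 2 * i + 1, 2 * j, 2 * j + 1} \<subseteq> {..<k}" "{u, v, w, z} \<subseteq> {..<k}"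
        using assms x U V by auto
      ultimately show ?thesis
        using card_permutes_prescribed4 by simp
    qed
  qed
  also have "\<dots> = (card U * card V)\<^sup>2 * fact (k - 4)"
    by (simp add: card_cartesian_product power2_eq_square)
  finally show ?thesis .
qed

lemma sum_card_linked:
  "(\<Sum>p\<in>perms. card (linked (k div 2) U V p)) = (k div 2) * (card U * card V * fact (k - 2))"
proof -
  have "(\<Sum>p\<in>perms. card (linked (k div 2) U V p)) =
      (\<Sum>p\<in>perms. \<Sum>i<k div 2. if p (2 * i) \<in> U \<and> p (2 * i + 1) \<in> V then 1 else 0)"
  proof (rule sum.cong[OF refl])
    fix p show "card (linked (k div 2) U V p) = (\<Sum>i<k div 2. if p (2 * i) \<in> U \<and> p (2 * i + 1) \<in> V then 1 else 0)"
      unfolding linked_def by (subst sum.If_cases) (auto intro: arg_cong[where f=card])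
  qed
  also have "\<dots> = (\<Sum>i<k div 2. \<Sum>p\<in>perms. if p (2 * i) \<in> U \<and> p (2 * i + 1) \<in> V then 1 else 0)"
    by (rule sum.swap)
  also have "\<dots> = (\<Sum>i<k div 2. card {p \<in> perms. p (2 * i) \<in> U \<and> p (2 * i + 1) \<in> V})"
    using fin by (intro sum.cong refl, subst sum.If_cases) (auto intro: arg_cong[where f=card])
  also have "\<dots> = (\<Sum>i<k div 2. card U * card V * fact (k - 2))"
    using card_permutes_link by simp
  finally show ?thesis by simp
qed

text \<open>The square is expanded into pairs of indices. The off-diagonal terms are joint events of
  two different S-D pairs; each diagonal term is a single event and reproduces the first
  moment.\<close>

lemma sum_card_linked_squared:
  "(\<Sum>p\<in>perms. (card (linked (k div 2) U V p))\<^sup>2)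
     \<le> (k div 2)\<^sup>2 * ((card U * card V)\<^sup>2 * fact (k - 4)) + (k div 2) * (card U * card V * fact (k - 2))"
proof -
  let ?m = "k div 2"
  let ?Q = "\<lambda>p i. p (2 * i) \<in> U \<and> p (2 * i + 1) \<in> V"
  have c: "card (linked ?m U V p) = (\<Sum>i<?m. if ?Q p i then 1 else 0)" for p
    unfolding linked_def by (subst sum.If_cases) (auto intro: arg_cong[where f=card])
  have "(\<Sum>p\<in>perms. (card (linked ?m U V p))\<^sup>2) =
      (\<Sum>p\<in>perms. \<Sum>i<?m. \<Sum>j<?m. if ?Q p i \<and> ?Q p j then 1 else 0)"
    unfolding c power2_eq_square sum_product by (intro sum.cong refl) auto
  also have "\<dots> = (\<Sum>i<?m. \<Sum>p\<in>perms. \<Sum>j<?m. if ?Q p i \<and> ?Q p j then 1 else 0)"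
    by (rule sum.swap)
  also have "\<dots> = (\<Sum>i<?m. \<Sum>j<?m. \<Sum>p\<in>perms. if ?Q p i \<and> ?Q p j then 1 else 0)"
    by (intro sum.cong refl, rule sum.swap)
  also have "\<dots> = (\<Sum>i<?m. \<Sum>j<?m. card {p \<in> perms. ?Q p i \<and> ?Q p j})"
    using fin by (intro sum.cong refl, subst sum.If_cases) (auto intro: arg_cong[where f=card])
  also have "\<dots> \<le> (\<Sum>i<?m. \<Sum>j<?m. (card U * card V)\<^sup>2 * fact (k - 4) + (if i = j then card U * card V * fact (k - 2) else 0))"
  proof (intro sum_mono)
    fix i j assume ij: "i \<in> {..<?m}" "j \<in> {..<?m}"
    show "card {p \<in> perms. ?Q p i \<and> ?Q p j} \<le> (card U * card V)\<^sup>2 * fact (k - 4) + (if i = j then card U * card V * fact (k - 2) else 0)"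
    proof (cases "i = j")
      case True
      then show ?thesis using card_permutes_link[of i] ij by simp
    next
      case False
      then show ?thesis using card_permutes_link2[of i j] ij by simp
    qed
  qed
  also have "\<dots> = ?m\<^sup>2 * ((card U * card V)\<^sup>2 * fact (k - 4)) + ?m * (card U * card V * fact (k - 2))"
    by (simp add: sum.distrib power2_eq_square algebra_simps)
  finally show ?thesis .
qed

end

section \<open>Second moment bound for the number of linked pairs\<close>

text \<open>Chebyshev's inequality in counting form. The relative variance is at most
  \<open>(\<rho> - 1) + 1 / \<mu>\<close>, and both terms are of order \<open>1 / k\<close>.\<close>

lemma card_few_linked_le:
  assumes U: "U \<subseteq> {..<k}" and V: "V \<subseteq> {..<k}" and disj: "U \<inter> V = {}"
    and k: "10 \<le> k" and lU: "real k / 12 \<le> real (card U)" and lV: "real k / 12 \<le> real (card V)"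
  shows "real (card {p. p permutes {..<k} \<and> real (card (linked (k div 2) U V p)) < real (k div 2) / 288})
    \<le> 1500 / real k * fact k"
proof -
  let ?P = "{p. p permutes {..<k}}"
  define m where "m = k div 2"
  define X where "X = (\<lambda>p. real (card (linked m U V p)))"
  define a where "a = real (card U * card V)"
  \<comment> \<open>The mean of \<open>X\<close> under a uniform permutation.\<close>
  define \<mu> where "\<mu> = real m * a / (real k * (real k - 1))"
  \<comment> \<open>The factor by which the off-diagonal second moment can exceed
    \<open>\<mu>\<^sup>2\<close>: the ratio of \<open>fact (k - 4) * fact k\<close> to
    \<open>(fact (k - 2))\<^sup>2\<close>.\<close>
  define \<rho> where "\<rho> = real k * (real k - 1) / ((real k - 2) * (real k - 3))"
  define F where "F = (fact k :: real)"
  define bad where "bad = {p. p permutes {..<k} \<and> X p < real m / 288}"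
  have fin: "finite ?P" by (rule finite_permutations) simp
  have F: "F > 0" by (simp add: F_def)
  \<comment> \<open>The rounding in \<open>k div 2\<close> costs at most 1/2, which is at most
    \<open>k / 20\<close> for \<open>k \<ge> 10\<close>.\<close>
  have m: "real m \<ge> 9/20 * real k"
  proof -
    have "2 * m + 1 \<ge> k" unfolding m_def by presburger
    then show ?thesis using k by linarith
  qed
  have "k = Suc (Suc (k - 2))" using k by simp
  then have "(fact k :: real) = real k * (real (Suc (k - 2)) * fact (k - 2))"
    by (metis fact_Suc of_nat_mult)
  then have f2: "fact (k - 2) = F / (real k * (real k - 1))"
    using k by (simp add: F_def of_nat_diff field_simps)
  have "k - 2 = Suc (Suc (k - 4))" using k by simp
  then have "(fact (k - 2) :: real) = real (k - 2) * (real (Suc (k - 4)) * fact (k - 4))"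
    by (metis fact_Suc of_nat_mult)
  then have "fact (k - 2) = ((real k - 2) * (real k - 3)) * fact (k - 4)"
    using k by (simp add: of_nat_diff algebra_simps)
  moreover have "(real k - 2) * (real k - 3) \<noteq> 0" using k by simp
  ultimately have "fact (k - 4) = fact (k - 2) / ((real k - 2) * (real k - 3))"
    by (metis nonzero_mult_div_cancel_left)
  then have f4: "fact (k - 4) = F / (real k * (real k - 1) * ((real k - 2) * (real k - 3)))"
    by (simp add: f2 field_simps)
  have "real (\<Sum>p\<in>?P. card (linked m U V p)) = real (m * (card U * card V * fact (k - 2)))"
    using sum_card_linked[OF U V disj] unfolding m_def by (rule arg_cong)
  then have "(\<Sum>p\<in>?P. X p) = real m * (a * fact (k - 2))"
    unfolding X_def a_def by simp
  then have s1: "(\<Sum>p\<in>?P. X p) = \<mu> * F" by (simp add: f2 \<mu>_def)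
  have "real (\<Sum>p\<in>?P. (card (linked m U V p))\<^sup>2)
      \<le> real (m\<^sup>2 * ((card U * card V)\<^sup>2 * fact (k - 4)) + m * (card U * card V * fact (k - 2)))"
    using sum_card_linked_squared[OF U V disj] unfolding m_def of_nat_le_iff by simp
  then have "(\<Sum>p\<in>?P. (X p)\<^sup>2) \<le> (real m)\<^sup>2 * (a\<^sup>2 * fact (k - 4)) + real m * (a * fact (k - 2))"
    unfolding X_def a_def by (simp add: power_mult_distrib)
  also have "real m * (a * fact (k - 2)) = \<mu> * F" by (simp add: f2 \<mu>_def)
  also have "(real m)\<^sup>2 * (a\<^sup>2 * fact (k - 4)) = \<mu>\<^sup>2 * \<rho> * F"
    using k by (simp add: f4 \<mu>_def \<rho>_def power2_eq_square)
  finally have s2: "(\<Sum>p\<in>?P. (X p)\<^sup>2) \<le> (\<mu>\<^sup>2 * \<rho> + \<mu>) * F" by (simp add: algebra_simps)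
  have "(\<Sum>p\<in>?P. (X p - \<mu>)\<^sup>2) = (\<Sum>p\<in>?P. (X p)\<^sup>2) - 2 * \<mu> * (\<Sum>p\<in>?P. X p) + \<mu>\<^sup>2 * F"
    by (simp add: power2_diff sum.distrib sum_subtractf sum_distrib_left F_def card_permutations algebra_simps)
  also have "\<dots> \<le> (\<mu>\<^sup>2 * (\<rho> - 1) + \<mu>) * F"
    using s1 s2 by (simp add: algebra_simps power2_eq_square)
  finally have var: "(\<Sum>p\<in>?P. (X p - \<mu>)\<^sup>2) \<le> (\<mu>\<^sup>2 * (\<rho> - 1) + \<mu>) * F" .
  have "real k * (real k - 1) / 144 \<le> (real k / 12) * (real k / 12)" by (simp add: field_simps)
  also have "\<dots> \<le> a" unfolding a_def of_nat_mult using lU lV by (intro mult_mono) auto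
  finally have "real m * (real k * (real k - 1) / 144) \<le> real m * a" by (rule mult_left_mono) simp
  then have \<mu>: "real m / 144 \<le> \<mu>" using k by (simp add: \<mu>_def field_simps)
  have \<mu>0: "\<mu> > 0" using \<mu> m k by linarith
  \<comment> \<open>A bad permutation has \<open>X p\<close> below \<open>m / 288\<close>, hence
    below \<open>\<mu> / 2\<close>, so it contributes at least \<open>(\<mu> / 2)\<^sup>2\<close> to
    the variance sum.\<close>
  have "real (card bad) * (\<mu> / 2)\<^sup>2 = (\<Sum>p\<in>bad. (\<mu> / 2)\<^sup>2)" by simp
  also have "\<dots> \<le> (\<Sum>p\<in>bad. (X p - \<mu>)\<^sup>2)"
  proof (rule sum_mono)
    fix p assume "p \<in> bad"
    then have "\<mu> / 2 \<le> \<mu> - X p" using \<mu> by (simp add: bad_def)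
    then have "(\<mu> / 2)\<^sup>2 \<le> (\<mu> - X p)\<^sup>2" using \<mu>0 by (intro power_mono) auto
    then show "(\<mu> / 2)\<^sup>2 \<le> (X p - \<mu>)\<^sup>2" by (simp add: power2_commute)
  qed
  also have "\<dots> \<le> (\<Sum>p\<in>?P. (X p - \<mu>)\<^sup>2)"
    by (rule sum_mono2[OF fin]) (auto simp: bad_def)
  also note var
  finally have "real (card bad) * \<mu>\<^sup>2 \<le> ((4 * (\<rho> - 1)) * \<mu>\<^sup>2 + 4 * \<mu>) * F"
    by (simp add: power_divide algebra_simps)
  also have "\<dots> = ((4 * (\<rho> - 1) + 4 / \<mu>) * F) * \<mu>\<^sup>2"
    using \<mu>0 by (simp add: field_simps power2_eq_square)
  finally have main: "real (card bad) \<le> (4 * (\<rho> - 1) + 4 / \<mu>) * F"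
    using \<mu>0 by simp
  have "\<rho> - 1 \<le> 8 / real k"
  proof -
    have d: "(real k - 2) * (real k - 3) > 0" using k by simp
    have "\<rho> - 1 = (real k * (real k - 1) - (real k - 2) * (real k - 3)) / ((real k - 2) * (real k - 3))"
      using k by (simp only: \<rho>_def diff_divide_distrib) simp
    also have "real k * (real k - 1) - (real k - 2) * (real k - 3) = 4 * real k - 6"
      by (simp add: algebra_simps)
    finally have "\<rho> - 1 = (4 * real k - 6) / ((real k - 2) * (real k - 3))" .
    also have "\<dots> \<le> 8 / real k"
    proof -
      have "10 * real k \<le> real k * real k" using k by (intro mult_right_mono) auto
      then have "(4 * real k - 6) * real k \<le> 8 * ((real k - 2) * (real k - 3))"
        by (simp add: algebra_simps)
      then show ?thesis using d k by (simp add: frac_le_eq divide_le_eq pos_le_divide_eq mult.commute)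
    qed
    finally show ?thesis .
  qed
  moreover have "4 / \<mu> \<le> 1280 / real k"
  proof -
    have "9/2880 * real k \<le> \<mu>" using \<mu> m by linarith
    then show ?thesis using \<mu>0 k by (simp add: field_simps)
  qed
  \<comment> \<open>The total is \<open>(4 * 8 + 1280) / k\<close>, rounded up to
    \<open>1500 / k\<close>.\<close>
  ultimately have "4 * (\<rho> - 1) + 4 / \<mu> \<le> 1500 / real k"
    using k by (simp add: field_simps)
  then have "(4 * (\<rho> - 1) + 4 / \<mu>) * F \<le> 1500 / real k * F"
    using F by (intro mult_right_mono) auto
  with main show ?thesis unfolding bad_def X_def F_def m_def by linarith
qed

section \<open>Hop counts and delays\<close>

lemma node_cell_in_grid:
  assumes "loc (tier A) v \<in> unit_square" "0 < grid A"
  shows "node_cell A v \<in> {0..<int (grid A)} \<times> {0..<int (grid A)}"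
proof -
  have "0 \<le> \<lfloor>real (grid A) * x\<rfloor> \<and> \<lfloor>real (grid A) * x\<rfloor> < int (grid A)" if "0 \<le> x" "x < 1" for x
    using that assms(2) by (simp add: floor_less_iff)
  then show ?thesis
    using assms(1) by (auto simp: node_cell_def unit_square_def)
qed

lemma hops_le:
  assumes "node_cell A (src (tier A) i) \<in> {0..<int (grid A)} \<times> {0..<int (grid A)}"
    and "node_cell A (dst (tier A) i) \<in> {0..<int (grid A)} \<times> {0..<int (grid A)}"
  shows "hops A i \<le> 2 * grid A"
proof -
  obtain x y x' y' where "node_cell A (src (tier A) i) = (x, y)" "node_cell A (dst (tier A) i) = (x', y')"
    by (metis surj_pair)
  then show ?thesis using assms by (auto simp: hops_def)
qed

lemma data_path_in_grid:
  assumes "node_cell A (src (tier A) i) \<in> {0..<int (grid A)} \<times> {0..<int (grid A)}"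
    and "node_cell A (dst (tier A) i) \<in> {0..<int (grid A)} \<times> {0..<int (grid A)}"
    and "h < hops A i"
  shows "data_path A i h \<in> {0..<int (grid A)} \<times> {0..<int (grid A)}"
proof -
  obtain x y x' y' where xy: "node_cell A (src (tier A) i) = (x, y)" "node_cell A (dst (tier A) i) = (x', y')"
    by (metis surj_pair)
  \<comment> \<open>The \<open>max 1\<close> in \<open>hops\<close> matters only if both ends share
    a cell; then \<open>h = 0\<close>, and the bound still holds.\<close>
  have h: "int h \<le> \<bar>x' - x\<bar> + \<bar>y' - y\<bar>" using assms(3) by (auto simp: hops_def xy)
  show ?thesis
    using assms(1,2) h by (auto simp: data_path_def xy sgn_if)
qed

text \<open>The horizontal leg alone has to cross the middle third of the columns; the two floors
  together cost at most one cell.\<close>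

lemma le_hops:
  assumes "fst (loc (tier A) (src (tier A) i)) < 1 / 3" "2 / 3 \<le> fst (loc (tier A) (dst (tier A) i))"
  shows "real (grid A) / 3 - 1 \<le> real (hops A i)"
proof -
  let ?K = "real (grid A)"
  let ?x = "\<lfloor>?K * fst (loc (tier A) (src (tier A) i))\<rfloor>" and ?x' = "\<lfloor>?K * fst (loc (tier A) (dst (tier A) i))\<rfloor>"
  have "?K * fst (loc (tier A) (src (tier A) i)) \<le> ?K * (1 / 3)"
    using assms by (intro mult_left_mono) auto
  moreover have "?K * (2 / 3) \<le> ?K * fst (loc (tier A) (dst (tier A) i))"
    using assms by (intro mult_left_mono) auto
  ultimately have "?K / 3 - 1 \<le> real_of_int (?x' - ?x)" by linarith
  also have "?x' - ?x \<le> int (hops A i)" by (simp add: hops_def node_cell_def)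
  finally show ?thesis by simp
qed

section \<open>TDMA timing and the delay of a single pair\<close>

lemma ex_residue_after:
  fixes r t :: nat
  assumes "r < 25"
  shows "\<exists>s>t. s \<le> t + 25 \<and> s mod 25 = r"
proof (intro exI conjI)
  \<comment> \<open>\<open>d\<close> is the distance from \<open>t + 25\<close> back to the last
    slot with residue \<open>r\<close>; adding 25 before subtracting \<open>r\<close> avoids
    truncated subtraction.\<close>
  define d where "d = (t + 25 - r) mod 25"
  have d: "d < 25" by (simp add: d_def)
  then show "t < t + 25 - d" "t + 25 - d \<le> t + 25" by simp_all
  have "t + 25 - d = r + 25 * ((t + 25 - r) div 25)"
    using assms mult_div_mod_eq[of 25 "t + 25 - r"] unfolding d_def by linarith
  then show "(t + 25 - d) mod 25 = r" using assms by simp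
qed

lemma hop_slot_Suc_bounds:
  assumes "opp A (data_path A i (Suc h)) = {s. s mod 25 = r}" "r < 25"
  shows "hop_slot A i j h < hop_slot A i j (Suc h)"
    and "hop_slot A i j (Suc h) \<le> hop_slot A i j h + 25"
proof -
  define t where "t = hop_slot A i j h"
  have e: "hop_slot A i j (Suc h) = (LEAST s. t < s \<and> s mod 25 = r)"
    by (simp add: assms(1) t_def)
  obtain s where s: "t < s" "s \<le> t + 25" "s mod 25 = r"
    using assms(2) by (metis (no_types) ex_residue_after)
  have "t < (LEAST s. t < s \<and> s mod 25 = r) \<and> (LEAST s. t < s \<and> s mod 25 = r) mod 25 = r"
    by (rule LeastI[of _ s]) (use s in auto)
  then show "hop_slot A i j h < hop_slot A i j (Suc h)" unfolding e by (simp add: t_def)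
  have "(LEAST s. t < s \<and> s mod 25 = r) \<le> s" using s by (intro Least_le) auto
  then show "hop_slot A i j (Suc h) \<le> hop_slot A i j h + 25" unfolding e using s t_def by simp
qed

text \<open>The assumption that transmission opportunities form full residue classes describes a
  network without preservation regions. It is what makes the timing of primary packets independent
  of the secondary network.\<close>

lemma hop_slot_bounds:
  assumes "\<And>c. \<exists>r<25. opp A c = {s. s mod 25 = r}"
  shows "hop_slot A i j 0 + h \<le> hop_slot A i j h \<and> hop_slot A i j h \<le> hop_slot A i j 0 + 25 * h"
proof (induction h)
  case (Suc h)
  obtain r where "r < 25" "opp A (data_path A i (Suc h)) = {s. s mod 25 = r}"
    using assms by blast
  from hop_slot_Suc_bounds[OF this(2,1), of j] Suc show ?case by simp
qed simp

text \<open>If the pair were missing from the packet order of its cell, the end could exceed the slot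
  by one (empty) packet slot; hence \<open>+ 2\<close>.\<close>

lemma pkt_time_bounds:
  assumes "0 \<le> slot_len A"
  shows "pkt_start A i j h \<le> slot_len A * (real (hop_slot A i j h) + 1)"
    and "slot_len A * real (hop_slot A i j h) \<le> pkt_start A i j h"
    and "slot_len A * real (hop_slot A i j h) \<le> pkt_end A i j h"
    and "pkt_end A i j h \<le> slot_len A * (real (hop_slot A i j h) + 2)"
proof -
  define ps where "ps = pkt_order (sched A) (data_path A i h) (hop_slot A i j h)"
  define l where "l = length (takeWhile (\<lambda>i'. i' \<noteq> i) ps)"
  have l: "l \<le> length ps" by (simp add: l_def length_takeWhile_le)
  have s: "pkt_start A i j h = slot_len A * (real (hop_slot A i j h) + real l / real (length ps))"
    and e: "pkt_end A i j h = slot_len A * (real (hop_slot A i j h) + real (l + 1) / real (length ps))"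
    by (simp_all add: pkt_start_def pkt_end_def pkt_time_def Let_def ps_def l_def)
  have "real l / real (length ps) \<le> 1" using l by (simp add: divide_le_eq_1)
  then show "pkt_start A i j h \<le> slot_len A * (real (hop_slot A i j h) + 1)"
    unfolding s using assms by (intro mult_left_mono) auto
  \<comment> \<open>For empty \<open>ps\<close> the quotient is 0, as division by zero gives 0;
    otherwise \<open>l + 1\<close> is at most twice the length.\<close>
  have "real (l + 1) / real (length ps) \<le> 2"
    using l by (cases "length ps") (auto simp: divide_le_eq)
  then show "pkt_end A i j h \<le> slot_len A * (real (hop_slot A i j h) + 2)"
    unfolding e using assms by (intro mult_left_mono) auto
  show "slot_len A * real (hop_slot A i j h) \<le> pkt_start A i j h"
    unfolding s using assms by (intro mult_left_mono) auto
  show "slot_len A * real (hop_slot A i j h) \<le> pkt_end A i j h"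
    unfolding e using assms by (intro mult_left_mono) auto
qed

text \<open>From the first to the last hop there are \<open>hops A i - 1\<close> waits of at least
  one slot each. One more slot is lost because the first packet slot may lie late in its slot. In
  the infinite case of \<open>packet_delay\<close> the bound is trivial.\<close>

lemma le_pair_delay:
  assumes "\<And>c. \<exists>r<25. opp A c = {s. s mod 25 = r}" "0 \<le> slot_len A"
  shows "ennreal (slot_len A * (real (hops A i) - 2)) \<le> pair_delay q L A B i"
  unfolding pair_delay_def
proof (rule le_limsup_average)
  fix j
  let ?H = "hops A i - 1"
  have "slot_len A * (real (hops A i) - 2) \<le> slot_len A * (real (hop_slot A i j ?H) - (real (hop_slot A i j 0) + 1))"
    using hop_slot_bounds[OF assms(1), of i j ?H] assms(2) by (intro mult_left_mono) auto
  also have "\<dots> \<le> pkt_end A i j ?H - pkt_start A i j 0"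
    using pkt_time_bounds(3)[OF assms(2), of i j ?H] pkt_time_bounds(1)[OF assms(2), of i j 0]
    by (simp add: algebra_simps)
  finally show "ennreal (slot_len A * (real (hops A i) - 2)) \<le> packet_delay q L A B i j"
    unfolding packet_delay_def by (auto intro: ennreal_leI)
qed

lemma pair_delay_le:
  assumes "\<And>c. \<exists>r<25. opp A c = {s. s mod 25 = r}" "0 \<le> slot_len A"
    and "i < num_pairs (tier A)" "served A i" "fluid q L A B"
  shows "pair_delay q L A B i \<le> ennreal (slot_len A * (25 * real (hops A i)))"
  unfolding pair_delay_def
proof (rule limsup_average_le)
  fix j
  let ?H = "hops A i - 1"
  have H: "1 \<le> hops A i" by (simp add: hops_def Let_def split_def)
  have "pkt_end A i j ?H - pkt_start A i j 0 \<le> slot_len A * (real (hop_slot A i j ?H) + 2 - real (hop_slot A i j 0))"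
    using pkt_time_bounds(4)[OF assms(2), of i j ?H] pkt_time_bounds(2)[OF assms(2), of i j 0]
    by (simp add: algebra_simps)
  \<comment> \<open>There are \<open>hops A i - 1\<close> waits of at most 25 slots, and the two
    extra slots fit into one further frame.\<close>
  also have "\<dots> \<le> slot_len A * (25 * real (hops A i))"
    using hop_slot_bounds[OF assms(1), of i j ?H] assms(2) H by (intro mult_left_mono) auto
  finally show "packet_delay q L A B i j \<le> ennreal (slot_len A * (25 * real (hops A i)))"
    using assms(3-5) unfolding packet_delay_def fluid_def by (auto intro: ennreal_leI)
qed

lemma opp_prim_net:
  assumes "valid_params q"
  shows "\<exists>r<25. opp (prim_net q n T S) c = {s. s mod 25 = r}"
proof -
  have "cluster_pos c \<in> {0..<5} \<times> {0..<5}" by (simp add: cluster_pos_def)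
  then have "turn1 q (cluster_pos c) \<in> {0..<25}"
    using assms unfolding valid_params_def by (metis bij_betwE)
  then show ?thesis by (auto simp: prim_net_def)
qed

lemma infinite_residue_class: "r < 25 \<Longrightarrow> infinite {s::nat. s mod 25 = r}"
  unfolding infinite_nat_iff_unbounded using ex_residue_after by (auto intro: mem_Collect_eq)

section \<open>Poisson points\<close>

text \<open>Markov's inequality for \<open>t ^ X\<close>, whose mean is
  \<open>exp ((t - 1) * r)\<close>: the function \<open>C * t ^ k\<close> dominates the indicator of
  \<open>S\<close>. Values \<open>t < 1\<close> serve lower tails and \<open>t > 1\<close> upper
  tails.\<close>

lemma (in prob_space) poisson_chernoff:
  fixes X :: "'a \<Rightarrow> nat" and r t C :: real
  assumes X: "X \<in> M \<rightarrow>\<^sub>M count_space UNIV"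
    and pois: "\<And>k. prob {\<omega>\<in>space M. X \<omega> = k} = exp (- r) * r ^ k / fact k"
    and "0 \<le> r" "0 \<le> t" "0 \<le> C" "\<And>k. k \<in> S \<Longrightarrow> 1 \<le> C * t ^ k"
  shows "prob {\<omega>\<in>space M. X \<omega> \<in> S} \<le> C * exp ((t - 1) * r)"
proof -
  note [measurable] = X
  define E where "E = (\<lambda>k. {\<omega>\<in>space M. X \<omega> = k \<and> k \<in> S})"
  have "(\<lambda>k. prob (E k)) sums prob (\<Union>k. E k)"
    by (rule finite_measure_UNION) (auto simp: E_def disjoint_family_on_def)
  moreover have "(\<Union>k. E k) = {\<omega>\<in>space M. X \<omega> \<in> S}" by (auto simp: E_def)
  ultimately have sums: "(\<lambda>k. prob (E k)) sums prob {\<omega>\<in>space M. X \<omega> \<in> S}" by simp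
  have "(\<lambda>k. (t * r) ^ k /\<^sub>R fact k) sums exp (t * r)"
    using exp_converges[of "t * r"] .
  then have "(\<lambda>k. C * exp (- r) * ((t * r) ^ k /\<^sub>R fact k)) sums (C * exp (- r) * exp (t * r))"
    by (rule sums_mult)
  moreover have "C * exp (- r) * exp (t * r) = C * exp ((t - 1) * r)"
    by (simp add: exp_add[symmetric] algebra_simps)
  ultimately have rhs: "(\<lambda>k. C * exp (- r) * ((t * r) ^ k /\<^sub>R fact k)) sums (C * exp ((t - 1) * r))"
    by simp
  show ?thesis
  proof (rule sums_le[OF _ sums rhs])
    fix k
    show "prob (E k) \<le> C * exp (- r) * ((t * r) ^ k /\<^sub>R fact k)"
    proof (cases "k \<in> S")
      case True
      then have "prob (E k) = 1 * (exp (- r) * r ^ k / fact k)" by (simp add: E_def pois)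
      also have "\<dots> \<le> (C * t ^ k) * (exp (- r) * r ^ k / fact k)"
        using assms True by (intro mult_right_mono) auto
      also have "\<dots> = C * exp (- r) * ((t * r) ^ k /\<^sub>R fact k)"
        by (simp add: power_mult_distrib divide_inverse)
      finally show ?thesis .
    next
      case False
      then show ?thesis using assms by (simp add: E_def)
    qed
  qed
qed

lemma (in prob_space) poisson_lower_tail:
  fixes X :: "'a \<Rightarrow> nat" and r :: real
  assumes X: "X \<in> M \<rightarrow>\<^sub>M count_space UNIV"
    and pois: "\<And>k. prob {\<omega>\<in>space M. X \<omega> = k} = exp (- r) * r ^ k / fact k" and "0 \<le> r"
  shows "prob {\<omega>\<in>space M. real (X \<omega>) < r / 2} \<le> exp ((ln 2 - 1) * (r / 2))"
proof -
  \<comment> \<open>The choice \<open>t = 1 / 2\<close>; the resulting exponent is negative because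
    \<open>ln 2 < 1\<close>.\<close>
  have "prob {\<omega>\<in>space M. X \<omega> \<in> {k. real k < r / 2}} \<le> 2 powr (r / 2) * exp ((1 / 2 - 1) * r)"
  proof (rule poisson_chernoff[OF X pois])
    fix k assume "k \<in> {k. real k < r / 2}"
    then have "2 powr real k \<le> 2 powr (r / 2)" by (intro powr_mono) auto
    then show "1 \<le> 2 powr (r / 2) * (1 / 2) ^ k"
      by (simp add: powr_realpow power_one_over divide_simps)
  qed (use assms in auto)
  also have "2 powr (r / 2) * exp ((1 / 2 - 1) * r) = exp ((ln 2 - 1) * (r / 2))"
    by (simp add: powr_def exp_add[symmetric] algebra_simps)
  finally show ?thesis by simp
qed

lemma (in prob_space) poisson_upper_tail:
  fixes X :: "'a \<Rightarrow> nat" and r :: real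
  assumes X: "X \<in> M \<rightarrow>\<^sub>M count_space UNIV"
    and pois: "\<And>k. prob {\<omega>\<in>space M. X \<omega> = k} = exp (- r) * r ^ k / fact k" and "0 \<le> r"
  shows "prob {\<omega>\<in>space M. 2 * r < real (X \<omega>)} \<le> exp ((1 - 2 * ln 2) * r)"
proof -
  \<comment> \<open>The choice \<open>t = 2\<close>; the resulting exponent is negative because
    \<open>2 * ln 2 > 1\<close>.\<close>
  have "prob {\<omega>\<in>space M. X \<omega> \<in> {k. 2 * r < real k}} \<le> 2 powr (- 2 * r) * exp ((2 - 1) * r)"
  proof (rule poisson_chernoff[OF X pois])
    fix k assume "k \<in> {k. 2 * r < real k}"
    then have "2 powr (2 * r) \<le> 2 powr real k" by (intro powr_mono) auto
    then show "1 \<le> 2 powr (- 2 * r) * 2 ^ k"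
      by (simp add: powr_realpow powr_minus divide_simps)
  qed (use assms in auto)
  also have "2 powr (- 2 * r) * exp ((2 - 1) * r) = exp ((1 - 2 * ln 2) * r)"
    by (simp add: powr_def exp_add[symmetric] algebra_simps)
  finally show ?thesis by simp
qed

section \<open>Node counts in rectangles and cells\<close>

lemma measure_lborel_rectangle:
  fixes a b c d :: real
  assumes "a \<le> b" "c \<le> d"
  shows "measure lborel ({a..<b} \<times> {c..<d}) = (b - a) * (d - c)"
proof -
  have "emeasure lborel ({a..<b} \<times> {c..<d}) = emeasure (lborel \<Otimes>\<^sub>M lborel) ({a..<b} \<times> {c..<d})"
    by (simp only: lborel_prod)
  also have "\<dots> = ennreal (b - a) * ennreal (d - c)"
    using assms by (subst lborel.emeasure_pair_measure_Times) auto
  finally show ?thesis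
    using assms by (simp add: measure_def flip: ennreal_mult)
qed

lemma borel_rectangle: "{a..<b} \<times> {c..<d} \<in> sets (borel :: (real \<times> real) measure)"
  by (simp add: borel_prod[symmetric])

text \<open>\<open>indep_vars\<close> includes the measurability of its variables, so the
  independence clause for a family with one member yields the claim.\<close>

lemma poisson_points_count_measurable:
  assumes "prob_space M" "poisson_points M lam T" "B \<in> sets borel" "B \<subseteq> unit_square"
  shows "(\<lambda>\<omega>. point_count (T \<omega>) B) \<in> M \<rightarrow>\<^sub>M count_space UNIV"
proof -
  interpret prob_space M by fact
  have "disjoint_family_on (\<lambda>_. B) {0::nat}" by (simp add: disjoint_family_on_def)
  then have "indep_vars (\<lambda>_. count_space UNIV) (\<lambda>j \<omega>. point_count (T \<omega>) B) {0::nat}"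
    using assms(2)[unfolded poisson_points_def] assms(3,4) by blast
  then show ?thesis by (simp add: indep_vars_def)
qed

lemma poisson_points_prob:
  assumes "poisson_points M lam T" "B \<in> sets borel" "B \<subseteq> unit_square"
  shows "measure M {\<omega>\<in>space M. point_count (T \<omega>) B = k} =
    exp (- (lam * measure lborel B)) * (lam * measure lborel B) ^ k / fact k"
  using assms unfolding poisson_points_def by blast

lemma whp_point_count_ge:
  assumes ps: "\<And>n. prob_space (M n)" and T: "\<And>n. poisson_points (M n) (real n) (T n)"
    and B: "B \<in> sets borel" "B \<subseteq> unit_square" and pos: "0 < measure lborel B"
  shows "whp M (\<lambda>n \<omega>. real n * measure lborel B / 2 \<le> real (point_count (T n \<omega>) B))"
proof (rule whpI[OF ps])
  let ?b = "measure lborel B"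
  let ?bad = "\<lambda>n. {\<omega>\<in>space (M n). real (point_count (T n \<omega>) B) < real n * ?b / 2}"
  show "?bad n \<in> sets (M n)" for n
    using poisson_points_count_measurable[OF ps T B, of n] by measurable
  show "(\<lambda>n. measure (M n) (?bad n)) \<longlonglongrightarrow> 0"
  proof (rule tendsto_sandwich[OF _ _ tendsto_const])
    show "\<forall>\<^sub>F n in sequentially. measure (M n) (?bad n) \<le> exp ((ln 2 - 1) * (real n * ?b / 2))"
      by (intro always_eventually allI prob_space.poisson_lower_tail[OF ps]
            poisson_points_count_measurable[OF ps T B] poisson_points_prob[OF T B]) simp
    have "filterlim (\<lambda>n. (ln 2 - 1) * (real n * ?b / 2)) at_bot sequentially"
    proof -
      have "(ln 2 - 1) * (?b / 2) < 0" using pos ln_2_less_1 by (simp add: mult_neg_pos)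
      then have "filterlim (\<lambda>n. ((ln 2 - 1) * (?b / 2)) * real n) at_bot sequentially"
        by (intro filterlim_tendsto_neg_mult_at_bot[OF tendsto_const] filterlim_real_sequentially)
      then show ?thesis by (simp add: mult_ac)
    qed
    then show "(\<lambda>n. exp ((ln 2 - 1) * (real n * ?b / 2))) \<longlonglongrightarrow> 0"
      by (rule filterlim_compose[OF exp_at_bot])
  qed (auto simp: always_eventually)
qed (auto simp: not_less)

lemma whp_point_count_le:
  assumes ps: "\<And>n. prob_space (M n)" and T: "\<And>n. poisson_points (M n) (real n) (T n)"
    and B: "B \<in> sets borel" "B \<subseteq> unit_square" and pos: "0 < measure lborel B"
  shows "whp M (\<lambda>n \<omega>. real (point_count (T n \<omega>) B) \<le> 2 * (real n * measure lborel B))"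
proof (rule whpI[OF ps])
  let ?b = "measure lborel B"
  let ?bad = "\<lambda>n. {\<omega>\<in>space (M n). 2 * (real n * ?b) < real (point_count (T n \<omega>) B)}"
  show "?bad n \<in> sets (M n)" for n
    using poisson_points_count_measurable[OF ps T B, of n] by measurable
  show "(\<lambda>n. measure (M n) (?bad n)) \<longlonglongrightarrow> 0"
  proof (rule tendsto_sandwich[OF _ _ tendsto_const])
    show "\<forall>\<^sub>F n in sequentially. measure (M n) (?bad n) \<le> exp ((1 - 2 * ln 2) * (real n * ?b))"
      by (intro always_eventually allI prob_space.poisson_upper_tail[OF ps]
            poisson_points_count_measurable[OF ps T B] poisson_points_prob[OF T B]) simp
    have "filterlim (\<lambda>n. (1 - 2 * ln 2) * (real n * ?b)) at_bot sequentially"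
    proof -
      have "(1 - 2 * ln 2) * ?b < 0" using pos ln2_ge_two_thirds by (simp add: mult_neg_pos)
      then have "filterlim (\<lambda>n. ((1 - 2 * ln 2) * ?b) * real n) at_bot sequentially"
        by (intro filterlim_tendsto_neg_mult_at_bot[OF tendsto_const] filterlim_real_sequentially)
      then show ?thesis by (simp add: mult_ac)
    qed
    then show "(\<lambda>n. exp ((1 - 2 * ln 2) * (real n * ?b))) \<longlonglongrightarrow> 0"
      by (rule filterlim_compose[OF exp_at_bot])
  qed (auto simp: always_eventually)
qed (auto simp: not_less)

text \<open>The fibre of \<open>node_cell\<close> over a cell as a Borel set, to which the Poisson
  law applies. The half-open sides match the floor function.\<close>

definition cell_square :: "nat \<Rightarrow> cell \<Rightarrow> point set" where
  "cell_square K c =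
     {of_int (fst c) / real K..<(of_int (fst c) + 1) / real K} \<times>
     {of_int (snd c) / real K..<(of_int (snd c) + 1) / real K}"

lemma mem_cell_square_iff:
  assumes "0 < grid A"
  shows "loc (tier A) v \<in> cell_square (grid A) c \<longleftrightarrow> node_cell A v = c"
proof -
  have "of_int i / real (grid A) \<le> x \<and> x < (of_int i + 1) / real (grid A) \<longleftrightarrow> \<lfloor>real (grid A) * x\<rfloor> = i" for i x
    using assms by (simp add: floor_eq_iff field_simps)
  then show ?thesis
    by (cases c; cases "loc (tier A) v") (simp add: cell_square_def node_cell_def)
qed

lemma point_count_cell_square:
  "0 < grid A \<Longrightarrow> point_count (tier A) (cell_square (grid A) c) = card (cell_nodes A c)"
  by (simp add: point_count_def cell_nodes_def mem_cell_square_iff)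

lemma cell_square_subset:
  assumes "c \<in> {0..<int K} \<times> {0..<int K}"
  shows "cell_square K c \<subseteq> unit_square"
proof -
  have "of_int i / real K \<ge> 0 \<and> (of_int i + 1) / real K \<le> 1" if "0 \<le> i" "i < int K" for i
    using that by (auto simp: divide_le_eq_1)
  moreover obtain i j where "c = (i, j)" by fastforce
  ultimately have "0 \<le> of_int i / real K" "(of_int i + 1) / real K \<le> 1"
    "0 \<le> of_int j / real K" "(of_int j + 1) / real K \<le> 1"
    using assms by auto
  then show ?thesis
    using \<open>c = (i, j)\<close> unfolding cell_square_def unit_square_def by (intro Sigma_mono) auto
qed

lemma measure_cell_square: "0 < K \<Longrightarrow> measure lborel (cell_square K c) = 1 / (real K)\<^sup>2"
  unfolding cell_square_def
  by (subst measure_lborel_rectangle) (auto simp: field_simps power2_eq_square)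

text \<open>Union bound over the \<open>K\<^sup>2\<close> cells, each of which is empty with probability \<open>exp (- n / K\<^sup>2)\<close>.\<close>

lemma whp_point_count_cells_pos:
  assumes ps: "\<And>n. prob_space (M n)" and T: "\<And>n. poisson_points (M n) (real n) (T n)"
    and K: "\<forall>\<^sub>F n in sequentially. 0 < K n"
    and lim: "(\<lambda>n. (real (K n))\<^sup>2 * exp (- (real n / (real (K n))\<^sup>2))) \<longlonglongrightarrow> 0"
  shows "whp M (\<lambda>n \<omega>. \<forall>c\<in>{0..<int (K n)} \<times> {0..<int (K n)}. 0 < point_count (T n \<omega>) (cell_square (K n) c))"
proof (rule whpI[OF ps])
  let ?C = "\<lambda>n. {0..<int (K n)} \<times> {0..<int (K n)}"
  let ?E = "\<lambda>n c. {\<omega>\<in>space (M n). point_count (T n \<omega>) (cell_square (K n) c) = 0}"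
  let ?bad = "\<lambda>n. \<Union>c\<in>?C n. ?E n c"
  have E: "?E n c \<in> sets (M n)" if "c \<in> ?C n" for n c
  proof -
    have [measurable]: "(\<lambda>\<omega>. point_count (T n \<omega>) (cell_square (K n) c)) \<in> M n \<rightarrow>\<^sub>M count_space UNIV"
      using that cell_square_subset
      by (intro poisson_points_count_measurable[OF ps T]) (auto simp: cell_square_def borel_rectangle)
    show ?thesis by measurable
  qed
  show "?bad n \<in> sets (M n)" for n
    by (rule sets.finite_UN) (auto intro: E)
  show "(\<lambda>n. measure (M n) (?bad n)) \<longlonglongrightarrow> 0"
  proof (rule tendsto_sandwich[OF _ _ tendsto_const lim])
    show "\<forall>\<^sub>F n in sequentially. measure (M n) (?bad n) \<le> (real (K n))\<^sup>2 * exp (- (real n / (real (K n))\<^sup>2))"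
      using K
    proof eventually_elim
      case (elim n)
      interpret prob_space "M n" by (rule ps)
      have "prob (?bad n) \<le> (\<Sum>c\<in>?C n. prob (?E n c))"
        by (rule finite_measure_subadditive_finite) (auto intro: E)
      also have "\<dots> = (\<Sum>c\<in>?C n. exp (- (real n / (real (K n))\<^sup>2)))"
      proof (rule sum.cong[OF refl])
        fix c assume c: "c \<in> ?C n"
        have "prob (?E n c) = exp (- (real n * measure lborel (cell_square (K n) c)))"
          using c cell_square_subset
          by (subst poisson_points_prob[OF T]) (auto simp: cell_square_def borel_rectangle)
        then show "prob (?E n c) = exp (- (real n / (real (K n))\<^sup>2))"
          using elim by (simp add: measure_cell_square)
      qed
      also have "\<dots> = (real (K n))\<^sup>2 * exp (- (real n / (real (K n))\<^sup>2))"
        by (simp add: card_cartesian_product power2_eq_square)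
      finally show ?case .
    qed
  qed (simp add: always_eventually)
qed (auto simp: always_eventually)

section \<open>Conditioning the pairing on the placement\<close>

text \<open>All that the crossing pairs need to know of the placement. Different triples
  \<open>(k, U, V)\<close> give disjoint events, so their probabilities can be added.\<close>

definition placement_pattern :: "point set \<Rightarrow> point set \<Rightarrow> nat \<Rightarrow> nat set \<Rightarrow> nat set \<Rightarrow> (nat \<times> (nat \<Rightarrow> point)) set" where
  "placement_pattern W E k U V =
     {(k', f). k' = k \<and> {v. v < k \<and> f v \<in> W} = U \<and> {v. v < k \<and> f v \<in> E} = V}"

lemma sets_placement_pattern:
  assumes [measurable]: "W \<in> sets borel" "E \<in> sets borel"
  shows "placement_pattern W E k U V \<in> sets placement_space"
proof -
  have [measurable]: "(\<lambda>f. f v) \<in> (\<Pi>\<^sub>M v\<in>(UNIV::nat set). (borel :: point measure)) \<rightarrow>\<^sub>M borel" for v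
    by (rule measurable_component_singleton) simp
  have sp: "space placement_space = UNIV"
    by (simp add: placement_space_def space_pair_measure space_PiM)
  \<comment> \<open>The equalities of index sets become countably many conditions on single
    coordinates, a form that \<open>measurable\<close> can decompose.\<close>
  have "placement_pattern W E k U V = {x \<in> space placement_space. fst x = k \<and>
      (\<forall>v. (v < k \<and> snd x v \<in> W) = (v \<in> U)) \<and> (\<forall>v. (v < k \<and> snd x v \<in> E) = (v \<in> V))}"
    unfolding sp by (rule set_eqI) (simp add: placement_pattern_def set_eq_iff split_beta mem_Times_iff)
  also have "\<dots> \<in> sets placement_space"
    unfolding placement_space_def by measurable
  finally show ?thesis .
qed

lemma tier_space_measurable:
  assumes [measurable]: "T \<in> M \<rightarrow>\<^sub>M tier_space"
  shows "(\<lambda>\<omega>. (num_nodes (T \<omega>), loc (T \<omega>))) \<in> M \<rightarrow>\<^sub>M placement_space"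
    and "{\<omega>\<in>space M. pairing (T \<omega>) = p} \<in> sets M"
proof -
  note [measurable] = assms[unfolded tier_space_def]
  show "(\<lambda>\<omega>. (num_nodes (T \<omega>), loc (T \<omega>))) \<in> M \<rightarrow>\<^sub>M placement_space"
    unfolding num_nodes_def loc_def placement_space_def by measurable
  have [measurable]: "(\<lambda>f. f v) \<in> (\<Pi>\<^sub>M v\<in>(UNIV::nat set). count_space (UNIV::nat set)) \<rightarrow>\<^sub>M count_space UNIV" for v
    by (rule measurable_component_singleton) simp
  show "{\<omega>\<in>space M. pairing (T \<omega>) = p} \<in> sets M"
    unfolding pairing_def fun_eq_iff by measurable
qed

text \<open>Total probability over the patterns in \<open>I\<close>: given a pattern, the pairing is
  uniform, so it falls into \<open>R k U V\<close> with conditional probability at most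
  \<open>\<delta>\<close>. The patterns are disjoint, so their probabilities sum to at most
  1.\<close>

lemma prob_unlucky_pairing:
  assumes ps: "prob_space M" and T: "random_tier M lam T"
    and WE: "W \<in> sets borel" "E \<in> sets borel"
    and "finite I" "\<And>k U V. (k, U, V) \<in> I \<Longrightarrow> R k U V \<subseteq> {p. p permutes {..<k}}"
    and le: "\<And>k U V. (k, U, V) \<in> I \<Longrightarrow> real (card (R k U V)) \<le> \<delta> * fact k" and "0 \<le> \<delta>"
  defines "Ev \<equiv> \<lambda>(k, U, V). \<lambda>p. {\<omega>\<in>space M. (num_nodes (T \<omega>), loc (T \<omega>)) \<in> placement_pattern W E k U V \<and>
     num_nodes (T \<omega>) = k \<and> pairing (T \<omega>) = p}"
  shows "(\<Union>x\<in>I. \<Union>p\<in>(case x of (k, U, V) \<Rightarrow> R k U V). Ev x p) \<in> sets M" (is "?B \<in> _")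
    and "measure M (\<Union>x\<in>I. \<Union>p\<in>(case x of (k, U, V) \<Rightarrow> R k U V). Ev x p) \<le> \<delta>"
proof -
  interpret prob_space M by fact
  have Tm: "T \<in> M \<rightarrow>\<^sub>M tier_space" and up: "uniform_pairing M T"
    using T by (auto simp: random_tier_def)
  define F where "F = (\<lambda>(k, U, V). {\<omega>\<in>space M. (num_nodes (T \<omega>), loc (T \<omega>)) \<in> placement_pattern W E k U V})"
  define Rx where "Rx = (\<lambda>(k, U, V). R k U V)"
  have F: "F x \<in> sets M" for x
  proof (cases x)
    case (fields k U V)
    have "F x = (\<lambda>\<omega>. (num_nodes (T \<omega>), loc (T \<omega>))) -` placement_pattern W E k U V \<inter> space M"
      by (auto simp: F_def fields)
    then show ?thesis
      using measurable_sets[OF tier_space_measurable(1)[OF Tm] sets_placement_pattern[OF WE]] by simp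
  qed
  have EvF: "Ev x p = F x \<inter> {\<omega>\<in>space M. pairing (T \<omega>) = p}" for x p
    by (cases x) (auto simp: Ev_def F_def placement_pattern_def)
  have Ev: "Ev x p \<in> sets M" for x p
    unfolding EvF using F tier_space_measurable(2)[OF Tm] by blast
  have finR: "finite (Rx x)" if "x \<in> I" for x
  proof (cases x)
    case (fields k U V)
    then show ?thesis using assms(6)[of k U V] that finite_permutations[of "{..<k}"]
      by (auto simp: Rx_def intro: finite_subset)
  qed
  have inner: "(\<Union>p\<in>Rx x. Ev x p) \<in> sets M" if "x \<in> I" for x
    by (rule sets.finite_UN) (use that finR Ev in auto)
  show "?B \<in> sets M"
    unfolding Rx_def[symmetric] by (rule sets.finite_UN) (use \<open>finite I\<close> inner in auto)
  have "measure M ?B \<le> (\<Sum>x\<in>I. measure M (\<Union>p\<in>Rx x. Ev x p))"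
    unfolding Rx_def[symmetric] using \<open>finite I\<close> inner by (intro finite_measure_subadditive_finite) auto
  also have "\<dots> \<le> (\<Sum>x\<in>I. \<delta> * measure M (F x))"
  proof (rule sum_mono)
    fix x assume x: "x \<in> I"
    obtain k U V where [simp]: "x = (k, U, V)" by (metis surj_pair)
    have "measure M (\<Union>p\<in>Rx x. Ev x p) \<le> (\<Sum>p\<in>Rx x. measure M (Ev x p))"
      using finR[OF x] Ev by (intro finite_measure_subadditive_finite) auto
    also have "\<dots> = (\<Sum>p\<in>Rx x. measure M (F x) / fact k)"
    proof (rule sum.cong[OF refl])
      fix p assume "p \<in> Rx x"
      then have p: "p permutes {..<k}" using assms(6)[of k U V] x by (auto simp: Rx_def)
      have "F x = {\<omega>\<in>space M. (num_nodes (T \<omega>), loc (T \<omega>)) \<in> placement_pattern W E k U V \<and> num_nodes (T \<omega>) = k}"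
        by (auto simp: F_def placement_pattern_def)
      then show "measure M (Ev x p) = measure M (F x) / fact k"
        using up p sets_placement_pattern[OF WE] unfolding uniform_pairing_def Ev_def by simp
    qed
    also have "\<dots> = (real (card (Rx x)) / fact k) * measure M (F x)" by simp
    also have "\<dots> \<le> \<delta> * measure M (F x)"
      using le[of k U V] x by (intro mult_right_mono) (auto simp: Rx_def divide_le_eq)
    finally show "measure M (\<Union>p\<in>Rx x. Ev x p) \<le> \<delta> * measure M (F x)" .
  qed
  also have "\<dots> = \<delta> * (\<Sum>x\<in>I. measure M (F x))" by (simp add: sum_distrib_left)
  also have "(\<Sum>x\<in>I. measure M (F x)) = measure M (\<Union>x\<in>I. F x)"
    using \<open>finite I\<close> F
    by (intro finite_measure_finite_Union[symmetric])
       (auto simp: disjoint_family_on_def F_def placement_pattern_def)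
  also have "\<delta> * measure M (\<Union>x\<in>I. F x) \<le> \<delta>"
    using \<open>0 \<le> \<delta>\<close> by (intro mult_left_le) auto
  finally show "measure M ?B \<le> \<delta>" .
qed

text \<open>The gap between the strips forces long horizontal legs, and their disjointness is what
  the permutation counts require.\<close>

definition west :: "point set" where "west = {0..<1/3} \<times> {0..<1}"
definition east :: "point set" where "east = {2/3..<1} \<times> {0..<1}"

lemma west_east:
  "west \<in> sets borel" "east \<in> sets borel" "west \<subseteq> unit_square" "east \<subseteq> unit_square"
  "measure lborel west = 1/3" "measure lborel east = 1/3" "west \<inter> east = {}"
  by (auto simp: west_def east_def borel_rectangle unit_square_def measure_lborel_rectangle)

lemma unit_square_lborel: "unit_square \<in> sets borel" "measure lborel unit_square = 1"
  by (auto simp: unit_square_def borel_rectangle measure_lborel_rectangle)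

definition crossing_pairs :: "tier \<Rightarrow> nat set" where
  "crossing_pairs T = {i. i < num_pairs T \<and> loc T (src T i) \<in> west \<and> loc T (dst T i) \<in> east}"

lemma whp_crossing_pairs:
  assumes ps: "\<And>n. prob_space (M n)" and T: "\<And>n. random_tier (M n) (real n) (T n)"
  shows "whp M (\<lambda>n \<omega>. 2 \<le> num_nodes (T n \<omega>) \<and>
     real (num_pairs (T n \<omega>)) / 288 \<le> real (card (crossing_pairs (T n \<omega>))))"
proof -
  have pp: "\<And>n. poisson_points (M n) (real n) (T n)" using T by (simp add: random_tier_def)
  define R where "R = (\<lambda>k U V. {p. p permutes {..<k} \<and> real (card (linked (k div 2) U V p)) < real (k div 2) / 288})"
  \<comment> \<open>The typical patterns. The bound \<open>2 * n\<close> makes the set finite,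
    \<open>n / 3\<close> turns \<open>1500 / k\<close> into \<open>4500 / n\<close>, and 1/12 is the
    quotient of \<open>n / 6\<close> and \<open>2 * n\<close>.\<close>
  define I where "I = (\<lambda>n. {(k, U, V). real n / 3 \<le> real k \<and> real k \<le> 2 * real n \<and> 10 \<le> k \<and> U \<subseteq> {..<k} \<and> V \<subseteq> {..<k} \<and>
     U \<inter> V = {} \<and> real k / 12 \<le> real (card U) \<and> real k / 12 \<le> real (card V)})"
  define bad where "bad = (\<lambda>n. \<Union>x\<in>I n. \<Union>p\<in>(case x of (k, U, V) \<Rightarrow> R k U V).
     (case x of (k, U, V) \<Rightarrow> \<lambda>p. {\<omega>\<in>space (M n). (num_nodes (T n \<omega>), loc (T n \<omega>)) \<in> placement_pattern west east k U V \<and>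
     num_nodes (T n \<omega>) = k \<and> pairing (T n \<omega>) = p}) p)"
  have finI: "finite (I n)" for n
    by (rule finite_subset[of _ "{..2 * n} \<times> Pow {..<2 * n} \<times> Pow {..<2 * n}"]) (auto simp: I_def)
  have R: "R k U V \<subseteq> {p. p permutes {..<k}}" for k U V by (auto simp: R_def)
  have le: "real (card (R k U V)) \<le> 4500 / real n * fact k" if "(k, U, V) \<in> I n" "0 < n" for n k U V
  proof -
    have "real (card (R k U V)) \<le> 1500 / real k * fact k"
      unfolding R_def using that by (intro card_few_linked_le) (auto simp: I_def)
    also have "\<dots> \<le> 4500 / real n * fact k"
      using that by (intro mult_right_mono) (auto simp: I_def field_simps)
    finally show ?thesis .
  qed
  have bad_set: "bad n \<in> sets (M n)" for n
  proof (cases "n = 0")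
    case False
    then show ?thesis unfolding bad_def
      by (intro prob_unlucky_pairing(1)[OF ps T west_east(1,2) finI R le]) auto
  next
    case True
    then have "I n = {}" by (auto simp: I_def)
    then show ?thesis by (simp add: bad_def)
  qed
  have bad_le: "measure (M n) (bad n) \<le> 4500 / real n" if "0 < n" for n
    unfolding bad_def using that
    by (intro prob_unlucky_pairing(2)[OF ps T west_east(1,2) finI R le]) auto
  have "whp M (\<lambda>n \<omega>. \<omega> \<notin> bad n)"
  proof (rule whpI[where M = M and bad = bad, OF ps bad_set])
    show "(\<lambda>n. measure (M n) (bad n)) \<longlonglongrightarrow> 0"
    proof (rule tendsto_sandwich[OF _ _ tendsto_const])
      show "\<forall>\<^sub>F n in sequentially. measure (M n) (bad n) \<le> 4500 / real n"
        using eventually_gt_at_top[of 0] by eventually_elim (rule bad_le)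
      show "(\<lambda>n. 4500 / real n) \<longlonglongrightarrow> 0"
        by (rule tendsto_divide_0[OF tendsto_const]) (simp add: filterlim_real_at_infinity_sequentially)
    qed simp
  qed simp
  moreover have "whp M (\<lambda>n \<omega>. real n / 6 \<le> real (point_count (T n \<omega>) west))"
    using whp_point_count_ge[OF ps pp west_east(1,3)] by (simp add: west_east)
  moreover have "whp M (\<lambda>n \<omega>. real n / 6 \<le> real (point_count (T n \<omega>) east))"
    using whp_point_count_ge[OF ps pp west_east(2,4)] by (simp add: west_east)
  moreover have "whp M (\<lambda>n \<omega>. real (point_count (T n \<omega>) unit_square) \<le> 2 * real n)"
    using whp_point_count_le[OF ps pp unit_square_lborel(1)] by (simp add: unit_square_lborel)
  ultimately have "whp M (\<lambda>n \<omega>. \<omega> \<notin> bad n \<and> real n / 6 \<le> real (point_count (T n \<omega>) west) \<and>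
      real n / 6 \<le> real (point_count (T n \<omega>) east) \<and> real (point_count (T n \<omega>) unit_square) \<le> 2 * real n)"
    by (intro whp_conj[OF ps])
  then show ?thesis
  proof (rule whp_mono[OF ps])
    show "\<forall>\<^sub>F n in sequentially. \<forall>\<omega>\<in>space (M n). \<omega> \<notin> bad n \<and> real n / 6 \<le> real (point_count (T n \<omega>) west) \<and>
        real n / 6 \<le> real (point_count (T n \<omega>) east) \<and> real (point_count (T n \<omega>) unit_square) \<le> 2 * real n \<longrightarrow>
        2 \<le> num_nodes (T n \<omega>) \<and> real (num_pairs (T n \<omega>)) / 288 \<le> real (card (crossing_pairs (T n \<omega>)))"
      \<comment> \<open>The two strips together hold at least \<open>n / 3\<close> nodes, so 30
        ensures \<open>10 \<le> k\<close>.\<close>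
      using eventually_ge_at_top[of 30]
    proof eventually_elim
      case (elim n)
      show ?case
      proof (intro ballI impI, elim conjE)
        fix \<omega>
        assume \<omega>: "\<omega> \<in> space (M n)" "\<omega> \<notin> bad n"
          and w: "real n / 6 \<le> real (point_count (T n \<omega>) west)"
          and e: "real n / 6 \<le> real (point_count (T n \<omega>) east)"
          and u: "real (point_count (T n \<omega>) unit_square) \<le> 2 * real n"
        define k where "k = num_nodes (T n \<omega>)"
        define U where "U = {v. v < k \<and> loc (T n \<omega>) v \<in> west}"
        define V where "V = {v. v < k \<and> loc (T n \<omega>) v \<in> east}"
        have UV: "U \<subseteq> {..<k}" "V \<subseteq> {..<k}" "U \<inter> V = {}"
          using west_east(7) by (auto simp: U_def V_def)
        then have fin: "finite U" "finite V" by (auto intro: finite_subset)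
        have "{v. v < k \<and> loc (T n \<omega>) v \<in> unit_square} = {..<k}"
          using pp[of n] \<omega> by (auto simp: poisson_points_def k_def)
        then have k: "real k \<le> 2 * real n" using u by (simp add: point_count_def k_def)
        have cU: "real n / 6 \<le> real (card U)" and cV: "real n / 6 \<le> real (card V)"
          using w e by (simp_all add: point_count_def k_def U_def V_def)
        have "card U + card V \<le> k"
          using card_mono[of "{..<k}" "U \<union> V"] UV fin by (simp add: card_Un_disjoint)
        then have k2: "real n / 3 \<le> real k" using cU cV by linarith
        then have k10: "10 \<le> k" using elim by linarith
        have I: "(k, U, V) \<in> I n"
          using UV k k2 k10 cU cV by (auto simp: I_def)
        have perm: "pairing (T n \<omega>) permutes {..<k}"
          using T[of n] \<omega> by (auto simp: random_tier_def uniform_pairing_def k_def)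
        have pat: "(num_nodes (T n \<omega>), loc (T n \<omega>)) \<in> placement_pattern west east k U V"
          by (simp add: placement_pattern_def k_def U_def V_def)
        have "pairing (T n \<omega>) \<notin> R k U V"
        proof
          assume "pairing (T n \<omega>) \<in> R k U V"
          then have "\<omega> \<in> bad n" unfolding bad_def using I pat \<omega> by (force simp: k_def)
          then show False using \<omega> by simp
        qed
        then have "real (k div 2) / 288 \<le> real (card (linked (k div 2) U V (pairing (T n \<omega>))))"
          using perm by (auto simp: R_def)
        also have "linked (k div 2) U V (pairing (T n \<omega>)) \<subseteq> crossing_pairs (T n \<omega>)"
          by (auto simp: linked_def crossing_pairs_def U_def V_def num_pairs_def k_def src_def dst_def)
        then have "card (linked (k div 2) U V (pairing (T n \<omega>))) \<le> card (crossing_pairs (T n \<omega>))"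
          by (intro card_mono) (auto simp: crossing_pairs_def)
        finally show "2 \<le> num_nodes (T n \<omega>) \<and> real (num_pairs (T n \<omega>)) / 288 \<le> real (card (crossing_pairs (T n \<omega>)))"
          using k10 by (simp add: num_pairs_def k_def)
      qed
    qed
  qed
qed

section \<open>Delay of the primary network\<close>

lemma prim_net_simps [simp]:
  "tier (prim_net q n T S) = T" "grid (prim_net q n T S) = grid_of (a_p q n)"
  "slot_len (prim_net q n T S) = tp q"
  by (simp_all add: prim_net_def)

lemma prim_net_cells_in_grid:
  fixes S :: schedule
  assumes "0 < grid_of (a_p q n)" and "\<forall>v<num_nodes T. loc T v \<in> unit_square"
    and "pairing T permutes {..<num_nodes T}" and "i < num_pairs T"
  defines "A \<equiv> prim_net q n T S"
  shows "node_cell A (src (tier A) i) \<in> {0..<int (grid A)} \<times> {0..<int (grid A)}"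
    and "node_cell A (dst (tier A) i) \<in> {0..<int (grid A)} \<times> {0..<int (grid A)}"
proof -
  have "2 * i < num_nodes T" "2 * i + 1 < num_nodes T"
    using assms(4) by (auto simp: num_pairs_def)
  then have "src T i < num_nodes T" "dst T i < num_nodes T"
    using permutes_in_image[OF assms(3)] unfolding src_def dst_def by auto
  moreover have "node_cell A v \<in> {0..<int (grid A)} \<times> {0..<int (grid A)}" if "v < num_nodes T" for v
    using assms(1,2) that by (intro node_cell_in_grid) (simp_all add: A_def)
  ultimately show "node_cell A (src (tier A) i) \<in> {0..<int (grid A)} \<times> {0..<int (grid A)}"
    "node_cell A (dst (tier A) i) \<in> {0..<int (grid A)} \<times> {0..<int (grid A)}"
    by (simp_all only: A_def prim_net_simps)
qed

lemma served_prim_net: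
  assumes "valid_params q" "0 < grid_of (a_p q n)" and "\<forall>v<num_nodes T. loc T v \<in> unit_square"
    and "pairing T permutes {..<num_nodes T}" and "i < num_pairs T"
    and "\<forall>c\<in>{0..<int (grid_of (a_p q n))} \<times> {0..<int (grid_of (a_p q n))}.
      0 < point_count T (cell_square (grid_of (a_p q n)) c)"
  shows "served (prim_net q n T S) i"
proof -
  let ?A = "prim_net q n T S"
  have "cell_nodes ?A (data_path ?A i h) \<noteq> {}" if "h < hops ?A i" for h
  proof -
    have "data_path ?A i h \<in> {0..<int (grid ?A)} \<times> {0..<int (grid ?A)}"
      by (rule data_path_in_grid[OF prim_net_cells_in_grid[OF assms(2-5)] that])
    then have "0 < point_count T (cell_square (grid ?A) (data_path ?A i h))"
      unfolding prim_net_simps by (rule bspec[OF assms(6)])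
    moreover have "0 < grid ?A" using assms(2) by simp
    ultimately have "0 < card (cell_nodes ?A (data_path ?A i h))"
      using point_count_cell_square[of ?A] by simp
    then show ?thesis by fastforce
  qed
  moreover have "infinite (opp ?A c)" for c
    using opp_prim_net[OF assms(1), of n T S c] infinite_residue_class by force
  ultimately show ?thesis unfolding served_def by blast
qed

lemma prim_delay_le:
  assumes q: "valid_params q" "0 < grid_of (a_p q n)" and T: "\<forall>v<num_nodes T1. loc T1 v \<in> unit_square"
    "pairing T1 permutes {..<num_nodes T1}"
    and cells: "\<forall>c\<in>{0..<int (grid_of (a_p q n))} \<times> {0..<int (grid_of (a_p q n))}.
      0 < point_count T1 (cell_square (grid_of (a_p q n)) c)"
    and Q: "prob_space Q"
    and fl: "AE \<xi> in Q. fluid q L (prim_net q n T1 (S1 \<xi>)) (sec_net q n (prim_net q n T1 (S1 \<xi>)) T2 (S2 \<xi>))"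
  shows "prim_delay q n L T1 T2 Q S1 S2 \<le> ennreal (50 * tp q * real (grid_of (a_p q n)))"
proof -
  interpret Q: prob_space Q by fact
  \<comment> \<open>25 slots for each of at most \<open>2 * grid\<close> hops.\<close>
  let ?D = "50 * tp q * real (grid_of (a_p q n))"
  have tp: "0 < tp q" using q by (simp add: valid_params_def)
  let ?f = "\<lambda>i \<xi>. let A = prim_net q n T1 (S1 \<xi>) in pair_delay q L A (sec_net q n A T2 (S2 \<xi>)) i"
  have I: "(\<integral>\<^sup>+ \<xi>. ?f i \<xi> \<partial>Q) \<le> ennreal ?D" if i: "i < num_pairs T1" for i
  proof -
    have "(\<integral>\<^sup>+ \<xi>. ?f i \<xi> \<partial>Q) \<le> (\<integral>\<^sup>+ \<xi>. ennreal ?D \<partial>Q)"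
    proof (rule nn_integral_mono_AE)
      show "AE \<xi> in Q. ?f i \<xi> \<le> ennreal ?D"
        using fl
      proof eventually_elim
        case (elim \<xi>)
        let ?A = "prim_net q n T1 (S1 \<xi>)"
        have "hops ?A i \<le> 2 * grid ?A"
          by (rule hops_le[OF prim_net_cells_in_grid[OF q(2) T i]])
        then have "real (hops ?A i) \<le> 2 * real (grid_of (a_p q n))" by simp
        then have "tp q * (25 * real (hops ?A i)) \<le> tp q * (25 * (2 * real (grid_of (a_p q n))))"
          using tp by (intro mult_left_mono) auto
        then have *: "tp q * (25 * real (hops ?A i)) \<le> ?D" by simp
        have "pair_delay q L ?A (sec_net q n ?A T2 (S2 \<xi>)) i \<le> ennreal (slot_len ?A * (25 * real (hops ?A i)))"
          using i tp by (intro pair_delay_le opp_prim_net q served_prim_net T cells elim) auto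
        also have "\<dots> \<le> ennreal ?D" using * by (intro ennreal_leI) simp
        finally show ?case by (simp add: Let_def)
      qed
    qed
    also have "\<dots> = ennreal ?D" by (simp add: Q.emeasure_space_1)
    finally show ?thesis .
  qed
  have "(\<Sum>i<num_pairs T1. \<integral>\<^sup>+ \<xi>. ?f i \<xi> \<partial>Q) \<le> (\<Sum>i<num_pairs T1. ennreal ?D)"
    by (intro sum_mono I) simp
  also have "\<dots> = ennreal (real (num_pairs T1) * ?D)"
    using tp by (simp add: ennreal_of_nat_eq_real_of_nat ennreal_mult)
  finally have "prim_delay q n L T1 T2 Q S1 S2 \<le> ennreal (2 / real (num_nodes T1)) * ennreal (real (num_pairs T1) * ?D)"
    unfolding prim_delay_def by (rule mult_left_mono) simp
  also have "\<dots> = ennreal ((2 / real (num_nodes T1) * real (num_pairs T1)) * ?D)"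
    using tp by (simp add: ennreal_mult[symmetric] mult.assoc)
  also have "\<dots> \<le> ennreal (1 * ?D)"
  proof (intro ennreal_leI mult_right_mono)
    \<comment> \<open>With an odd number of nodes, the normalization \<open>2 / num_nodes\<close>
      slightly undercounts the average over pairs, which is harmless for an upper bound.\<close>
    have "2 * num_pairs T1 \<le> num_nodes T1" by (simp add: num_pairs_def)
    then have "2 * real (num_pairs T1) \<le> real (num_nodes T1)" by linarith
    then show "2 / real (num_nodes T1) * real (num_pairs T1) \<le> 1"
      by (cases "num_nodes T1 = 0") (auto simp: divide_le_eq)
  qed (use tp in simp)
  finally show ?thesis by simp
qed

lemma le_prim_delay:
  assumes q: "valid_params q" and N: "2 \<le> num_nodes T1"
    and X: "real (num_pairs T1) / 288 \<le> real (card (crossing_pairs T1))"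
    and Q: "prob_space Q" and K: "9 \<le> grid_of (a_p q n)"
  shows "ennreal (tp q * (real (grid_of (a_p q n)) / 3 - 3) / 432) \<le> prim_delay q n L T1 T2 Q S1 S2"
proof -
  interpret Q: prob_space Q by fact
  \<comment> \<open>The 3 adds the one cell lost in \<open>le_hops\<close> and the two slots lost in
    \<open>le_pair_delay\<close>. The hypothesis \<open>9 \<le> grid_of (a_p q n)\<close> makes this
    nonnegative.\<close>
  let ?D = "tp q * (real (grid_of (a_p q n)) / 3 - 3)"
  have tp: "0 < tp q" using q by (simp add: valid_params_def)
  have D: "0 \<le> ?D" using tp K by simp
  let ?f = "\<lambda>i \<xi>. let A = prim_net q n T1 (S1 \<xi>) in pair_delay q L A (sec_net q n A T2 (S2 \<xi>)) i"
  have I: "ennreal ?D \<le> (\<integral>\<^sup>+ \<xi>. ?f i \<xi> \<partial>Q)" if i: "i \<in> crossing_pairs T1" for i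
  proof -
    have "ennreal ?D = (\<integral>\<^sup>+ \<xi>. ennreal ?D \<partial>Q)" by (simp add: Q.emeasure_space_1)
    also have "\<dots> \<le> (\<integral>\<^sup>+ \<xi>. ?f i \<xi> \<partial>Q)"
    proof (rule nn_integral_mono)
      fix \<xi>
      let ?A = "prim_net q n T1 (S1 \<xi>)"
      have "real (grid ?A) / 3 - 1 \<le> real (hops ?A i)"
        using i by (intro le_hops) (auto simp: crossing_pairs_def west_def east_def mem_Times_iff)
      then have "?D \<le> slot_len ?A * (real (hops ?A i) - 2)"
        using tp by (simp add: mult_left_mono)
      then have "ennreal ?D \<le> ennreal (slot_len ?A * (real (hops ?A i) - 2))" by (rule ennreal_leI)
      also have "\<dots> \<le> pair_delay q L ?A (sec_net q n ?A T2 (S2 \<xi>)) i"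
        using tp by (intro le_pair_delay opp_prim_net q) auto
      finally show "ennreal ?D \<le> ?f i \<xi>" by (simp add: Let_def)
    qed
    finally show ?thesis .
  qed
  have "ennreal (real (card (crossing_pairs T1)) * ?D) = (\<Sum>i\<in>crossing_pairs T1. ennreal ?D)"
    using D by (simp add: ennreal_of_nat_eq_real_of_nat ennreal_mult)
  also have "\<dots> \<le> (\<Sum>i\<in>crossing_pairs T1. \<integral>\<^sup>+ \<xi>. ?f i \<xi> \<partial>Q)"
    by (intro sum_mono I)
  also have "\<dots> \<le> (\<Sum>i<num_pairs T1. \<integral>\<^sup>+ \<xi>. ?f i \<xi> \<partial>Q)"
    by (rule sum_mono2) (auto simp: crossing_pairs_def)
  finally have le: "ennreal (2 / real (num_nodes T1)) * ennreal (real (card (crossing_pairs T1)) * ?D)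
      \<le> prim_delay q n L T1 T2 Q S1 S2"
    unfolding prim_delay_def by (rule mult_left_mono) simp
  have eq: "ennreal (2 / real (num_nodes T1)) * ennreal (real (card (crossing_pairs T1)) * ?D)
      = ennreal ((2 / real (num_nodes T1) * real (card (crossing_pairs T1))) * ?D)"
    using D by (simp add: ennreal_mult[symmetric] mult.assoc)
  have "ennreal (1 / 432 * ?D) \<le> ennreal ((2 / real (num_nodes T1) * real (card (crossing_pairs T1))) * ?D)"
  proof (intro ennreal_leI mult_right_mono D)
    \<comment> \<open>The extreme case is three nodes forming one pair. Then
      \<open>864 = 3 * 288\<close>, and \<open>432\<close> is half of it.\<close>
    have "num_nodes T1 \<le> 3 * num_pairs T1" using N unfolding num_pairs_def by presburger
    then have "real (num_nodes T1) \<le> 3 * real (num_pairs T1)" by linarith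
    then have "real (num_nodes T1) \<le> 864 * real (card (crossing_pairs T1))" using X by linarith
    then show "1 / 432 \<le> 2 / real (num_nodes T1) * real (card (crossing_pairs T1))"
      using N by (simp add: le_divide_eq)
  qed
  also note eq[symmetric]
  also note le
  finally show ?thesis by simp
qed

section \<open>Asymptotics of the primary grid\<close>

lemma grid_of_bounds:
  assumes "0 < a"
  shows "real (grid_of a) \<le> 1 / sqrt a" and "1 / sqrt a - 1 \<le> real (grid_of a)"
proof -
  have "0 \<le> 1 / sqrt a" using assms by simp
  then have "real (grid_of a) = real_of_int \<lfloor>1 / sqrt a\<rfloor>" by (simp add: grid_of_def)
  then show "real (grid_of a) \<le> 1 / sqrt a" "1 / sqrt a - 1 \<le> real (grid_of a)" by linarith+
qed

text \<open>The threshold 24 (with \<open>576 = 24\<^sup>2\<close>) leaves room to absorb the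
  additive losses of the lower bound into a constant factor.\<close>

lemma eventually_a_p_bounds:
  assumes "1 \<le> k1 q"
  shows "\<forall>\<^sub>F n in sequentially. 0 < a_p q n \<and> ln (real n) / real n \<le> a_p q n \<and> 24 \<le> 1 / sqrt (a_p q n)"
proof -
  have lim: "(\<lambda>n. a_p q n) \<longlonglongrightarrow> 0"
    unfolding a_p_def by real_asymp
  have "\<forall>\<^sub>F n in sequentially. a_p q n < 1 / 576"
    using order_tendstoD(2)[OF lim, of "1 / 576"] by simp
  then show ?thesis using eventually_ge_at_top[of 2]
  proof eventually_elim
    case (elim n)
    have ln: "0 < ln (real n) / real n" using elim by simp
    have "1 * (ln (real n) / real n) \<le> k1 q * (ln (real n) / real n)"
      using assms ln by (intro mult_right_mono) auto
    then have le: "ln (real n) / real n \<le> a_p q n" by (simp add: a_p_def)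
    then have pos: "0 < a_p q n" using ln by linarith
    have "sqrt (a_p q n) \<le> sqrt (1 / 576)" using elim by (intro real_sqrt_le_mono) auto
    also have "sqrt (1 / 576) = 1 / (24::real)" by (rule real_sqrt_unique) (auto simp: power2_eq_square)
    finally have "24 \<le> 1 / sqrt (a_p q n)" using pos by (simp add: field_simps)
    then show ?case using le pos by blast
  qed
qed

text \<open>Here \<open>1 \<le> k1 q\<close> is decisive: with rounding down it gives
  \<open>K\<^sup>2 \<le> n / ln n\<close>, so each cell is empty with probability at most
  \<open>1 / n\<close>, and the product is at most \<open>1 / ln n\<close>.\<close>

lemma prim_grid_void_tendsto:
  assumes "1 \<le> k1 q"
  shows "(\<lambda>n. (real (grid_of (a_p q n)))\<^sup>2 * exp (- (real n / (real (grid_of (a_p q n)))\<^sup>2))) \<longlonglongrightarrow> 0"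
proof (rule tendsto_sandwich[OF _ _ tendsto_const])
  show "\<forall>\<^sub>F n in sequentially. (real (grid_of (a_p q n)))\<^sup>2 * exp (- (real n / (real (grid_of (a_p q n)))\<^sup>2))
      \<le> 1 / ln (real n)"
    using eventually_a_p_bounds[OF assms] eventually_ge_at_top[of 2]
  proof eventually_elim
    case (elim n)
    let ?K = "real (grid_of (a_p q n))"
    have a: "0 < a_p q n" and le: "ln (real n) / real n \<le> a_p q n" using elim by auto
    have K: "0 < ?K" using grid_of_bounds(2)[OF a] elim by linarith
    have ln: "0 < ln (real n)" using elim by simp
    have "?K\<^sup>2 \<le> (1 / sqrt (a_p q n))\<^sup>2"
      using grid_of_bounds(1)[OF a] by (intro power_mono) auto
    also have "\<dots> = 1 / a_p q n" using a by (simp add: power_divide)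
    also have "\<dots> \<le> 1 / (ln (real n) / real n)" using le ln elim a by (intro divide_left_mono) auto
    finally have K2: "?K\<^sup>2 \<le> real n / ln (real n)" by simp
    then have "ln (real n) \<le> real n / ?K\<^sup>2" using K ln by (simp add: field_simps)
    then have "exp (- (real n / ?K\<^sup>2)) \<le> exp (- ln (real n))" by simp
    also have "\<dots> = 1 / real n" using elim by (simp add: exp_minus inverse_eq_divide)
    finally have "?K\<^sup>2 * exp (- (real n / ?K\<^sup>2)) \<le> (real n / ln (real n)) * (1 / real n)"
      using K2 ln by (intro mult_mono) auto
    then show ?case using elim by simp
  qed
  show "(\<lambda>n. 1 / ln (real n)) \<longlonglongrightarrow> 0" by real_asymp
qed simp

theorem theorem1:
  fixes q :: params
    and M :: "nat \<Rightarrow> 'w measure" and T1 T2 :: "nat \<Rightarrow> 'w \<Rightarrow> tier"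
    and Q :: "nat \<Rightarrow> 's measure" and S1 S2 :: "nat \<Rightarrow> 'w \<Rightarrow> 's \<Rightarrow> schedule"
    and L :: "nat \<Rightarrow> 'w \<Rightarrow> real"
  defines "A \<equiv> \<lambda>n \<omega> \<xi>. prim_net q n (T1 n \<omega>) (S1 n \<omega> \<xi>)"
  defines "B \<equiv> \<lambda>n \<omega> \<xi>. sec_net q n (A n \<omega> \<xi>) (T2 n \<omega>) (S2 n \<omega> \<xi>)"
  assumes "valid_params q"
    and "\<And>n. prob_space (M n)"
    and "\<And>n. random_tier (M n) (real n) (T1 n)"
    and "\<And>n. random_tier (M n) (dens2 q n) (T2 n)"
    and "\<And>n. prob_space.indep_var (M n) tier_space (T1 n) tier_space (T2 n)"
    and "\<And>n. prob_space (Q n)"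
    and "\<And>n \<omega>. \<omega> \<in> space (M n) \<Longrightarrow> random_schedule (Q n) (S1 n \<omega>)"
    and "\<And>n \<omega>. \<omega> \<in> space (M n) \<Longrightarrow> random_schedule (Q n) (S2 n \<omega>)"
    and "\<And>n \<omega> \<xi>. \<omega> \<in> space (M n) \<Longrightarrow> \<xi> \<in> space (Q n) \<Longrightarrow> valid_schedule (A n \<omega> \<xi>)"
    and "\<And>n \<omega> \<xi>. \<omega> \<in> space (M n) \<Longrightarrow> \<xi> \<in> space (Q n) \<Longrightarrow> valid_schedule (B n \<omega> \<xi>)"
    and "whp M (\<lambda>n \<omega>. AE \<xi> in Q n. fluid q (L n \<omega>) (A n \<omega> \<xi>) (B n \<omega> \<xi>))"
  shows "\<exists>c C. 0 < c \<and> 0 < C \<and>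
           whp M (\<lambda>n \<omega>.
             ennreal (c * (1 / sqrt (a_p q n)))
               \<le> prim_delay q n (L n \<omega>) (T1 n \<omega>) (T2 n \<omega>) (Q n) (S1 n \<omega>) (S2 n \<omega>) \<and>
             prim_delay q n (L n \<omega>) (T1 n \<omega>) (T2 n \<omega>) (Q n) (S1 n \<omega>) (S2 n \<omega>)
               \<le> ennreal (C * (1 / sqrt (a_p q n))))"
proof -
  note ps = assms(4) and q = assms(3) and Q = assms(8)
  have k1: "1 \<le> k1 q" and tp: "0 < tp q" using q by (auto simp: valid_params_def)
  have T: "\<And>n. random_tier (M n) (real n) (T1 n)" by fact
  then have pp: "\<And>n. poisson_points (M n) (real n) (T1 n)" by (simp add: random_tier_def)
  let ?K = "\<lambda>n. grid_of (a_p q n)"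
  have K: "\<forall>\<^sub>F n in sequentially. 0 < ?K n"
    using eventually_a_p_bounds[OF k1]
  proof eventually_elim
    case (elim n)
    then show ?case using grid_of_bounds(2)[of "a_p q n"] by linarith
  qed
  have "whp M (\<lambda>n \<omega>. (AE \<xi> in Q n. fluid q (L n \<omega>) (A n \<omega> \<xi>) (B n \<omega> \<xi>)) \<and>
      (\<forall>c\<in>{0..<int (?K n)} \<times> {0..<int (?K n)}. 0 < point_count (T1 n \<omega>) (cell_square (?K n) c)) \<and>
      2 \<le> num_nodes (T1 n \<omega>) \<and> real (num_pairs (T1 n \<omega>)) / 288 \<le> real (card (crossing_pairs (T1 n \<omega>))))"
    by (intro whp_conj[OF ps] assms(13) whp_point_count_cells_pos[OF ps pp K prim_grid_void_tendsto[OF k1]]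
          whp_crossing_pairs[OF ps T])
  then have "whp M (\<lambda>n \<omega>.
      ennreal (tp q / 3456 * (1 / sqrt (a_p q n)))
        \<le> prim_delay q n (L n \<omega>) (T1 n \<omega>) (T2 n \<omega>) (Q n) (S1 n \<omega>) (S2 n \<omega>) \<and>
      prim_delay q n (L n \<omega>) (T1 n \<omega>) (T2 n \<omega>) (Q n) (S1 n \<omega>) (S2 n \<omega>)
        \<le> ennreal (50 * tp q * (1 / sqrt (a_p q n))))"
  proof (rule whp_mono[OF ps], intro eventually_mono[OF eventually_a_p_bounds[OF k1]] ballI impI, elim conjE)
    fix n \<omega>
    assume \<omega>: "\<omega> \<in> space (M n)"
      and fl: "AE \<xi> in Q n. fluid q (L n \<omega>) (A n \<omega> \<xi>) (B n \<omega> \<xi>)"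
      and cells: "\<forall>c\<in>{0..<int (?K n)} \<times> {0..<int (?K n)}. 0 < point_count (T1 n \<omega>) (cell_square (?K n) c)"
      and N: "2 \<le> num_nodes (T1 n \<omega>)"
      and X: "real (num_pairs (T1 n \<omega>)) / 288 \<le> real (card (crossing_pairs (T1 n \<omega>)))"
      and a: "0 < a_p q n" "24 \<le> 1 / sqrt (a_p q n)"
    let ?D = "prim_delay q n (L n \<omega>) (T1 n \<omega>) (T2 n \<omega>) (Q n) (S1 n \<omega>) (S2 n \<omega>)"
    let ?s = "1 / sqrt (a_p q n)"
    note gb = grid_of_bounds[OF a(1)]
    have K9: "9 \<le> ?K n" "0 < ?K n" using gb(2) a(2) by linarith+
    have locs: "\<forall>v<num_nodes (T1 n \<omega>). loc (T1 n \<omega>) v \<in> unit_square"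
      using pp[of n] \<omega> by (auto simp: poisson_points_def)
    have perm: "pairing (T1 n \<omega>) permutes {..<num_nodes (T1 n \<omega>)}"
      using T[of n] \<omega> by (auto simp: random_tier_def uniform_pairing_def)
    have "?D \<le> ennreal (50 * tp q * real (?K n))"
      using fl unfolding A_def B_def by (intro prim_delay_le q K9 locs perm cells Q)
    also have "\<dots> \<le> ennreal (50 * tp q * ?s)"
      using gb(1) tp by (intro ennreal_leI mult_left_mono) auto
    finally have upper: "?D \<le> ennreal (50 * tp q * ?s)" .
    \<comment> \<open>\<open>(s - 1) / 3 - 3\<close> exceeds \<open>s / 8\<close> from
      \<open>s = 16\<close> on. The constant \<open>3456 = 8 * 432\<close> then combines this loss
      with that of \<open>le_prim_delay\<close>.\<close>
    have "s / 8 \<le> K / 3 - 3" if "24 \<le> s" "s - 1 \<le> K" for s K :: real using that by linarith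
    from this[OF a(2) gb(2)] have "?s / 8 \<le> real (?K n) / 3 - 3" .
    then have "tp q * (?s / 8) \<le> tp q * (real (?K n) / 3 - 3)" using tp by (intro mult_left_mono) auto
    then have "tp q / 3456 * ?s \<le> tp q * (real (?K n) / 3 - 3) / 432" by simp
    then have "ennreal (tp q / 3456 * ?s) \<le> ennreal (tp q * (real (?K n) / 3 - 3) / 432)" by (rule ennreal_leI)
    also have "\<dots> \<le> ?D" by (rule le_prim_delay[OF q N X Q K9(1)])
    finally show "ennreal (tp q / 3456 * ?s) \<le> ?D \<and> ?D \<le> ennreal (50 * tp q * ?s)"
      using upper by blast
  qed
  moreover have "0 < tp q / 3456" "0 < 50 * tp q" using tp by simp_all
  ultimately show ?thesis by blast
qed

end
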